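(* Let $R$ be a unital commutative ring. The class of generalized Boolean dynamical system algebras and the class of generalized labelled space algebras are the same. That is, an $R$-algebra is isomorphic to $L_R(\mathcal B,\mathcal L,\theta,\mathcal I)$ for some generalized Boolean dynamical system $(\mathcal B,\mathcal L,\theta,\mathcal I)$ if and only if it is isomorphic to $L_R(\mathcal E,\mathcal L,\mathcal B,\mathcal I)$ for some generalized (weakly left-resolving normal) labelled space $(\mathcal E,\mathcal L,\mathcal B,\mathcal I)$.
   Context: A generalized Boolean algebra $\mathcal B$ is a distributive lattice with relative complements and a least element $\emptyset$; write $\cup,\cap,\setminus,\subseteq$ for join, meet, relative complement and order. Morphisms preserve $\emptyset$ and all operations. An ideal is a nonempty subset closed under $\cup$ and under $\cap$ with arbitrary elements of $\mathcal B$. A generalized Boolean dynamical system $(\mathcal B,\mathcal L,\theta,\mathcal I)$ consists of a generalized Boolean algebra $\mathcal B$, a set $\mathcal L$, morphisms $\theta_\alpha:\mathcal B\to\mathcal B$ ($\alpha\in\mathcal L$), and ideals $\mathcal I_\alpha$ ($\alpha\in\mathcal L$) with $\{A\in\mathcal B:A\subseteq\theta_\alpha(B)\text{ for some }B\in\mathcal B\}\subseteq\mathcal I_\alpha$. Put $\Delta_A=\{\alpha\in\mathcal L:\theta_\alpha(A)\ne\emptyset\}$ and $\mathcal B_{\mathrm{reg}}=\{A\in\mathcal B:0<|\Delta_B|<\infty\text{ for all }\emptyset\ne B\subseteq A\}$. $L_R(\mathcal B,\mathcal L,\theta,\mathcal I)$ is the universal associative (not necessarily unital) $R$-algebra generated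 by $\{p_A\}_{A\in\mathcal B}\cup\{s_{\alpha,B},s_{\alpha,B}^*\}_{\alpha\in\mathcal L,B\in\mathcal I_\alpha}$ subject to: (1) $p_\emptyset=0$, $p_{A\cap A'}=p_Ap_{A'}$, $p_{A\cup A'}=p_A+p_{A'}-p_{A\cap A'}$; (2) $p_As_{\alpha,B}=s_{\alpha,B}p_{\theta_\alpha(A)}$ and $s_{\alpha,B}^*p_A=p_{\theta_\alpha(A)}s_{\alpha,B}^*$; (3) $s_{\alpha,B}^*s_{\alpha',B'}=\delta_{\alpha,\alpha'}p_{B\cap B'}$; (4) $s_{\alpha,B}p_{B'}=s_{\alpha,B\cap B'}$ and $p_{B'}s_{\alpha,B}^*=s_{\alpha,B\cap B'}^*$; (5) $p_A=\sum_{\alpha\in\Delta_A}s_{\alpha,\theta_\alpha(A)}s_{\alpha,\theta_\alpha(A)}^*$ for all $A\in\mathcal B_{\mathrm{reg}}$. Labelled spaces: a labelled graph $(\mathcal E,\mathcal L)$ is a directed graph $\mathcal E$ (vertices $\mathcal E^0$, edges $\mathcal E^1$, source and range maps $s,r$) with an alphabet $\mathcal L$ and a labelling map $\mathcal E^1\to\mathcal L$. For $A\subseteq\mathcal E^0$, $a\in\mathcal L$, let $r(A,a)=\{v\in\mathcal E^0:\exists e\in\mathcal E^1\text{ with label }a,\ s(e)\in A,\ r(e)=v\}$. A set $\mathcal B$ of subsets of $\mathcal E^0$ containing $\emptyset$, closed under finite unions and intersections, is an accommodating family if $r(A,a)\in\mathcal B$ for all $A\in\mathcal B,a\in\mathcal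 L$ (it is not required that $r(\mathcal E^0,a)\in\mathcal B$); then $(\mathcal E,\mathcal L,\mathcal B)$ is a labelled space. It is normal if $\mathcal B$ is closed under relative complements, and weakly left-resolving if $r(A\cap B,a)=r(A,a)\cap r(B,a)$ for all $A,B\in\mathcal B$, $a\in\mathcal L$. A generalized (weakly left-resolving normal) labelled space $(\mathcal E,\mathcal L,\mathcal B,\mathcal I)$ is a weakly left-resolving normal labelled space with ideals $\mathcal I_a$ of $\mathcal B$ ($a\in\mathcal L$) such that $\{A\in\mathcal B:A\subseteq r(B,a)\text{ for some }B\in\mathcal B\}\subseteq\mathcal I_a$. The algebra $L_R(\mathcal E,\mathcal L,\mathcal B,\mathcal I)$ is the universal associative $R$-algebra on generators $\{p_A\}_{A\in\mathcal B}\cup\{s_{a,A},s_{a,A}^*\}_{a\in\mathcal L,A\in\mathcal I_a}$ subject to: (1) $p_\emptyset=0$, $p_{A\cap B}=p_Ap_B$, $p_{A\cup B}=p_A+p_B-p_{A\cap B}$; (2) $p_Bs_{a,A}=s_{a,A}p_{r(B,a)}$, $s_{a,A}^*p_B=p_{r(B,a)}s_{a,A}^*$; (3) $s_{a,A}^*s_{a',A'}=\delta_{a,a'}p_{A\cap A'}$; (4) $s_{a,A}p_B=s_{a,A\cap B}$, $p_Bs_{a,A}^*=s_{a,A\cap B}^*$; (5) $p_A=\sum_{a\in\Delta_A}s_{a,r(A,a)}s_{a,r(A,a)}^*$ for all $A\in\mathcal B_{\mathrm{reg}}$, where $\Delta_A=\{a\in\mathcal L:r(A,a)\neq\emptyset\}$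 and $\mathcal B_{\mathrm{reg}}=\{A\in\mathcal B:0<|\Delta_B|<\infty\text{ for all }\emptyset\neq B\subseteq A,\ B\in\mathcal B\}$. *)

theory Defs
  imports "HOL-Algebra.Lattice" "HOL-Algebra.Module" "Graph_Theory.Digraph"
begin

section \<open>Associative, not necessarily unital algebras\<close>

text \<open>The \<open>one\<close> field, which records of type \<open>module\<close> inherit from \<open>ring\<close>, plays no role here.
  A zero ring \<open>R\<close> is allowed.\<close>

locale nonunital_algebra = Module.module R A for R and A (structure) +
  assumes mult_closed: "\<lbrakk>x \<in> carrier A; y \<in> carrier A\<rbrakk> \<Longrightarrow> x \<otimes> y \<in> carrier A"
    and mult_assoc: "\<lbrakk>x \<in> carrier A; y \<in> carrier A; z \<in> carrier A\<rbrakk> \<Longrightarrow>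
      (x \<otimes> y) \<otimes> z = x \<otimes> (y \<otimes> z)"
    and mult_l_distr: "\<lbrakk>x \<in> carrier A; y \<in> carrier A; z \<in> carrier A\<rbrakk> \<Longrightarrow>
      (x \<oplus> y) \<otimes> z = x \<otimes> z \<oplus> y \<otimes> z"
    and mult_r_distr: "\<lbrakk>x \<in> carrier A; y \<in> carrier A; z \<in> carrier A\<rbrakk> \<Longrightarrow>
      z \<otimes> (x \<oplus> y) = z \<otimes> x \<oplus> z \<otimes> y"
    and smult_mult_l: "\<lbrakk>a \<in> carrier R; x \<in> carrier A; y \<in> carrier A\<rbrakk> \<Longrightarrow>
      (a \<odot> x) \<otimes> y = a \<odot> (x \<otimes> y)"
    and smult_mult_r: "\<lbrakk>a \<in> carrier R; x \<in> carrier A; y \<in> carrier A\<rbrakk> \<Longrightarrow>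
      x \<otimes> (a \<odot> y) = a \<odot> (x \<otimes> y)"

definition algebra_hom ::
    "('r, 'm) ring_scheme \<Rightarrow> ('r, 'a, 'n) module_scheme \<Rightarrow> ('r, 'c, 'k) module_scheme \<Rightarrow> ('a \<Rightarrow> 'c) set"
  where "algebra_hom R A C =
    {f. f \<in> hom (add_monoid A) (add_monoid C) \<and> f \<in> hom A C \<and>
        (\<forall>a\<in>carrier R. \<forall>x\<in>carrier A. f (a \<odot>\<^bsub>A\<^esub> x) = a \<odot>\<^bsub>C\<^esub> f x)}"

definition algebra_isomorphic ::
    "('r, 'm) ring_scheme \<Rightarrow> ('r, 'a, 'n) module_scheme \<Rightarrow> ('r, 'c, 'k) module_scheme \<Rightarrow> bool"
  where "algebra_isomorphic R A C \<longleftrightarrow>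
    (\<exists>f \<in> algebra_hom R A C. bij_betw f (carrier A) (carrier C))"


section \<open>Algebras given by generators and relations\<close>

datatype ('r, 'x) aterm =
    AGen 'x
  | AZero
  | AAdd "('r, 'x) aterm" "('r, 'x) aterm"
  | ANeg "('r, 'x) aterm"
  | ASmult 'r "('r, 'x) aterm"
  | AMult "('r, 'x) aterm" "('r, 'x) aterm"

definition ASum :: "('r, 'x) aterm list \<Rightarrow> ('r, 'x) aterm"
  where "ASum ts = foldr AAdd ts AZero"

inductive_set aterms :: "('r, 'm) ring_scheme \<Rightarrow> 'x set \<Rightarrow> ('r, 'x) aterm set"
  for R :: "('r, 'm) ring_scheme" and X :: "'x set" where
  gen: "x \<in> X \<Longrightarrow> AGen x \<in> aterms R X"
| zero: "AZero \<in> aterms R X"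
| add: "\<lbrakk>s \<in> aterms R X; t \<in> aterms R X\<rbrakk> \<Longrightarrow> AAdd s t \<in> aterms R X"
| neg: "t \<in> aterms R X \<Longrightarrow> ANeg t \<in> aterms R X"
| smult: "\<lbrakk>a \<in> carrier R; t \<in> aterms R X\<rbrakk> \<Longrightarrow> ASmult a t \<in> aterms R X"
| mult: "\<lbrakk>s \<in> aterms R X; t \<in> aterms R X\<rbrakk> \<Longrightarrow> AMult s t \<in> aterms R X"

text \<open>The least congruence on the terms over \<open>X\<close> that contains the relations \<open>E\<close> and all instances
  of the axioms of an associative \<open>R\<close>-algebra.\<close>

inductive aeq ::
    "('r, 'm) ring_scheme \<Rightarrow> 'x set \<Rightarrow> (('r, 'x) aterm \<times> ('r, 'x) aterm) set \<Rightarrow>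
     ('r, 'x) aterm \<Rightarrow> ('r, 'x) aterm \<Rightarrow> bool"
  for R :: "('r, 'm) ring_scheme" and X :: "'x set"
    and E :: "(('r, 'x) aterm \<times> ('r, 'x) aterm) set" where
  relation: "\<lbrakk>(s, t) \<in> E; s \<in> aterms R X; t \<in> aterms R X\<rbrakk> \<Longrightarrow> aeq R X E s t"
| refl: "t \<in> aterms R X \<Longrightarrow> aeq R X E t t"
| sym: "aeq R X E s t \<Longrightarrow> aeq R X E t s"
| trans: "\<lbrakk>aeq R X E s t; aeq R X E t u\<rbrakk> \<Longrightarrow> aeq R X E s u"
| cong_add: "\<lbrakk>aeq R X E s s'; aeq R X E t t'\<rbrakk> \<Longrightarrow> aeq R X E (AAdd s t) (AAdd s' t')"
| cong_neg: "aeq R X E t t' \<Longrightarrow> aeq R X E (ANeg t) (ANeg t')"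
| cong_smult: "\<lbrakk>a \<in> carrier R; aeq R X E t t'\<rbrakk> \<Longrightarrow> aeq R X E (ASmult a t) (ASmult a t')"
| cong_mult: "\<lbrakk>aeq R X E s s'; aeq R X E t t'\<rbrakk> \<Longrightarrow> aeq R X E (AMult s t) (AMult s' t')"
| add_assoc: "\<lbrakk>s \<in> aterms R X; t \<in> aterms R X; u \<in> aterms R X\<rbrakk> \<Longrightarrow>
    aeq R X E (AAdd (AAdd s t) u) (AAdd s (AAdd t u))"
| add_comm: "\<lbrakk>s \<in> aterms R X; t \<in> aterms R X\<rbrakk> \<Longrightarrow> aeq R X E (AAdd s t) (AAdd t s)"
| add_zero: "t \<in> aterms R X \<Longrightarrow> aeq R X E (AAdd AZero t) t"
| add_neg: "t \<in> aterms R X \<Longrightarrow> aeq R X E (AAdd (ANeg t) t) AZero"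
| smult_l_distr: "\<lbrakk>a \<in> carrier R; b \<in> carrier R; t \<in> aterms R X\<rbrakk> \<Longrightarrow>
    aeq R X E (ASmult (a \<oplus>\<^bsub>R\<^esub> b) t) (AAdd (ASmult a t) (ASmult b t))"
| smult_r_distr: "\<lbrakk>a \<in> carrier R; s \<in> aterms R X; t \<in> aterms R X\<rbrakk> \<Longrightarrow>
    aeq R X E (ASmult a (AAdd s t)) (AAdd (ASmult a s) (ASmult a t))"
| smult_assoc: "\<lbrakk>a \<in> carrier R; b \<in> carrier R; t \<in> aterms R X\<rbrakk> \<Longrightarrow>
    aeq R X E (ASmult (a \<otimes>\<^bsub>R\<^esub> b) t) (ASmult a (ASmult b t))"
| smult_one: "t \<in> aterms R X \<Longrightarrow> aeq R X E (ASmult \<one>\<^bsub>R\<^esub> t) t"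
| mult_assoc: "\<lbrakk>s \<in> aterms R X; t \<in> aterms R X; u \<in> aterms R X\<rbrakk> \<Longrightarrow>
    aeq R X E (AMult (AMult s t) u) (AMult s (AMult t u))"
| mult_l_distr: "\<lbrakk>s \<in> aterms R X; t \<in> aterms R X; u \<in> aterms R X\<rbrakk> \<Longrightarrow>
    aeq R X E (AMult (AAdd s t) u) (AAdd (AMult s u) (AMult t u))"
| mult_r_distr: "\<lbrakk>s \<in> aterms R X; t \<in> aterms R X; u \<in> aterms R X\<rbrakk> \<Longrightarrow>
    aeq R X E (AMult u (AAdd s t)) (AAdd (AMult u s) (AMult u t))"
| smult_mult_l: "\<lbrakk>a \<in> carrier R; s \<in> aterms R X; t \<in> aterms R X\<rbrakk> \<Longrightarrow>
    aeq R X E (AMult (ASmult a s) t) (ASmult a (AMult s t))"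
| smult_mult_r: "\<lbrakk>a \<in> carrier R; s \<in> aterms R X; t \<in> aterms R X\<rbrakk> \<Longrightarrow>
    aeq R X E (AMult s (ASmult a t)) (ASmult a (AMult s t))"

definition aclass ::
    "('r, 'm) ring_scheme \<Rightarrow> 'x set \<Rightarrow> (('r, 'x) aterm \<times> ('r, 'x) aterm) set \<Rightarrow>
     ('r, 'x) aterm \<Rightarrow> ('r, 'x) aterm set"
  where "aclass R X E t = {u. aeq R X E t u}"

text \<open>The universal associative \<open>R\<close>-algebra generated by \<open>X\<close> subject to the relations \<open>E\<close>.\<close>

definition presented_algebra ::
    "('r, 'm) ring_scheme \<Rightarrow> 'x set \<Rightarrow> (('r, 'x) aterm \<times> ('r, 'x) aterm) set \<Rightarrow>
     ('r, ('r, 'x) aterm set) module"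
  where "presented_algebra R X E =
    \<lparr>carrier = aclass R X E ` aterms R X,
     mult = (\<lambda>U V. \<Union>s\<in>U. \<Union>t\<in>V. aclass R X E (AMult s t)),
     one = undefined,
     zero = aclass R X E AZero,
     add = (\<lambda>U V. \<Union>s\<in>U. \<Union>t\<in>V. aclass R X E (AAdd s t)),
     smult = (\<lambda>a U. \<Union>t\<in>U. aclass R X E (ASmult a t))\<rparr>"

primrec aeval :: "('r, 'a, 'n) module_scheme \<Rightarrow> ('x \<Rightarrow> 'a) \<Rightarrow> ('r, 'x) aterm \<Rightarrow> 'a" where
  "aeval A \<phi> (AGen x) = \<phi> x"
| "aeval A \<phi> AZero = \<zero>\<^bsub>A\<^esub>"
| "aeval A \<phi> (AAdd s t) = aeval A \<phi> s \<oplus>\<^bsub>A\<^esub> aeval A \<phi> t"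
| "aeval A \<phi> (ANeg t) = \<ominus>\<^bsub>A\<^esub> aeval A \<phi> t"
| "aeval A \<phi> (ASmult a t) = a \<odot>\<^bsub>A\<^esub> aeval A \<phi> t"
| "aeval A \<phi> (AMult s t) = aeval A \<phi> s \<otimes>\<^bsub>A\<^esub> aeval A \<phi> t"

lemma aeq_in_aterms: "aeq R X E s t \<Longrightarrow> cring R \<Longrightarrow> s \<in> aterms R X \<and> t \<in> aterms R X"
  by (induction rule: aeq.induct)
     (auto intro!: aterms.intros cring.cring_simprules(1) cring.cring_simprules(5,6))

lemma aclass_eq_iff:
  assumes "s \<in> aterms R X" "t \<in> aterms R X"
  shows "aclass R X E s = aclass R X E t \<longleftrightarrow> aeq R X E s t"
  using assms by (auto simp: aclass_def intro: aeq.refl aeq.sym aeq.trans)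

lemma aclass_eqI: "aeq R X E s t \<Longrightarrow> aclass R X E s = aclass R X E t"
  by (auto simp: aclass_def intro: aeq.sym aeq.trans)

lemma presented_algebra_ops:
  assumes "cring R"
  shows "\<lbrakk>s \<in> aterms R X; t \<in> aterms R X\<rbrakk> \<Longrightarrow>
      aclass R X E s \<otimes>\<^bsub>presented_algebra R X E\<^esub> aclass R X E t = aclass R X E (AMult s t)"
    and "\<lbrakk>s \<in> aterms R X; t \<in> aterms R X\<rbrakk> \<Longrightarrow>
      aclass R X E s \<oplus>\<^bsub>presented_algebra R X E\<^esub> aclass R X E t = aclass R X E (AAdd s t)"
    and "\<lbrakk>a \<in> carrier R; t \<in> aterms R X\<rbrakk> \<Longrightarrow>
      a \<odot>\<^bsub>presented_algebra R X E\<^esub> aclass R X E t = aclass R X E (ASmult a t)"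
    and "\<zero>\<^bsub>presented_algebra R X E\<^esub> = aclass R X E AZero"
    and "carrier (presented_algebra R X E) = aclass R X E ` aterms R X"
proof -
  show "aclass R X E s \<otimes>\<^bsub>presented_algebra R X E\<^esub> aclass R X E t = aclass R X E (AMult s t)"
    if "s \<in> aterms R X" "t \<in> aterms R X"
    using that unfolding presented_algebra_def aclass_def
    by (auto intro: aeq.refl aeq.trans aeq.sym aeq.cong_mult)
  show "aclass R X E s \<oplus>\<^bsub>presented_algebra R X E\<^esub> aclass R X E t = aclass R X E (AAdd s t)"
    if "s \<in> aterms R X" "t \<in> aterms R X"
    using that unfolding presented_algebra_def aclass_def
    by (auto intro: aeq.refl aeq.trans aeq.sym aeq.cong_add)
  show "a \<odot>\<^bsub>presented_algebra R X E\<^esub> aclass R X E t = aclass R X E (ASmult a t)"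
    if "a \<in> carrier R" "t \<in> aterms R X"
    using that unfolding presented_algebra_def aclass_def
    by (auto intro: aeq.refl aeq.trans aeq.sym aeq.cong_smult)
qed (simp_all add: presented_algebra_def)

lemma presented_algebra_is_algebra:
  assumes R: "cring R"
  shows "nonunital_algebra R (presented_algebra R X E)"
proof -
  interpret R: cring R by (rule R)
  note ops = presented_algebra_ops[OF R] and I = aterms.intros
  have "abelian_group (presented_algebra R X E)"
  proof (rule abelian_groupI)
    fix x assume "x \<in> carrier (presented_algebra R X E)"
    then obtain t where t: "t \<in> aterms R X" "x = aclass R X E t" by (auto simp: ops)
    then show "\<exists>y\<in>carrier (presented_algebra R X E).
        y \<oplus>\<^bsub>presented_algebra R X E\<^esub> x = \<zero>\<^bsub>presented_algebra R X E\<^esub>"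
      by (intro bexI[of _ "aclass R X E (ANeg t)"])
         (auto simp: ops I del: equalityI intro!: aclass_eqI intro: aeq.add_neg)
  qed (auto simp: ops I del: equalityI intro!: aclass_eqI intro: aeq.add_assoc aeq.add_comm aeq.add_zero)
  then have "Module.module R (presented_algebra R X E)"
    by (intro moduleI R)
       (auto simp: ops I del: equalityI intro!: aclass_eqI
          intro: aeq.smult_l_distr aeq.smult_r_distr aeq.smult_assoc aeq.smult_one)
  then show ?thesis
    by (intro nonunital_algebra.intro nonunital_algebra_axioms.intro)
       (auto simp: ops I del: equalityI intro!: aclass_eqI
          intro: aeq.mult_assoc aeq.mult_l_distr aeq.mult_r_distr aeq.smult_mult_l aeq.smult_mult_r)
qed

lemma (in nonunital_algebra) aeval_closed:
  assumes "\<phi> \<in> X \<rightarrow> carrier A" "t \<in> aterms R X"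
  shows "aeval A \<phi> t \<in> carrier A"
  using assms(2) by induction (use assms(1) in \<open>auto intro: mult_closed\<close>)

lemma (in nonunital_algebra) aeval_aeq:
  assumes \<phi>: "\<phi> \<in> X \<rightarrow> carrier A"
    and E: "\<And>s t. \<lbrakk>(s, t) \<in> E; s \<in> aterms R X; t \<in> aterms R X\<rbrakk> \<Longrightarrow> aeval A \<phi> s = aeval A \<phi> t"
    and "aeq R X E s t"
  shows "aeval A \<phi> s = aeval A \<phi> t"
  using assms(3)
  by induction
     (auto simp: E aeval_closed[OF \<phi>] smult_l_distr smult_r_distr smult_assoc1 mult_assoc
        mult_l_distr mult_r_distr smult_mult_l smult_mult_r
        M.l_neg intro: M.a_assoc M.a_comm)

text \<open>The universal property.\<close>

lemma presented_algebra_relations: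
  assumes R: "cring R" and E: "(s, t) \<in> E" and st: "s \<in> aterms R X" "t \<in> aterms R X"
  shows "aeval (presented_algebra R X E) (\<lambda>x. aclass R X E (AGen x)) s =
    aeval (presented_algebra R X E) (\<lambda>x. aclass R X E (AGen x)) t"
proof -
  interpret P: nonunital_algebra R "presented_algebra R X E"
    by (rule presented_algebra_is_algebra[OF R])
  note ops = presented_algebra_ops[OF R] and I = aterms.intros
  have eval: "aeval (presented_algebra R X E) (\<lambda>x. aclass R X E (AGen x)) u = aclass R X E u"
    if "u \<in> aterms R X" for u
    using that
  proof induction
    case (neg t)
    then have "aclass R X E (ANeg t) \<oplus>\<^bsub>presented_algebra R X E\<^esub> aclass R X E t
      = \<zero>\<^bsub>presented_algebra R X E\<^esub>"
      by (simp add: ops I aclass_eq_iff aeq.add_neg)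
    then have "\<ominus>\<^bsub>presented_algebra R X E\<^esub> aclass R X E t = aclass R X E (ANeg t)"
      using neg by (intro P.minus_equality) (auto simp: ops I)
    then show ?case using neg by simp
  qed (simp_all add: ops)
  show ?thesis using E st by (simp add: eval aclass_eq_iff aeq.relation)
qed

lemma presented_algebra_universal:
  fixes A (structure)
  assumes "nonunital_algebra R A" and \<phi>: "\<phi> \<in> X \<rightarrow> carrier A"
    and E: "\<And>s t. \<lbrakk>(s, t) \<in> E; s \<in> aterms R X; t \<in> aterms R X\<rbrakk> \<Longrightarrow> aeval A \<phi> s = aeval A \<phi> t"
  shows "\<exists>f \<in> algebra_hom R (presented_algebra R X E) A.
    (\<forall>x\<in>X. f (aclass R X E (AGen x)) = \<phi> x) \<and>
    (\<forall>g \<in> algebra_hom R (presented_algebra R X E) A. (\<forall>x\<in>X. g (aclass R X E (AGen x)) = \<phi> x) \<longrightarrow>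
      (\<forall>u \<in> carrier (presented_algebra R X E). g u = f u))"
proof -
  interpret A: nonunital_algebra R A by fact
  have R: "cring R" ..
  interpret P: nonunital_algebra R "presented_algebra R X E"
    by (rule presented_algebra_is_algebra[OF R])
  note ops = presented_algebra_ops[OF R] and I = aterms.intros
  define f where "f U = aeval A \<phi> (SOME t. t \<in> U)" for U
  have f: "f (aclass R X E t) = aeval A \<phi> t" if "t \<in> aterms R X" for t
  proof -
    have "aeq R X E t (SOME u. u \<in> aclass R X E t)"
      using someI[of "\<lambda>u. u \<in> aclass R X E t" t] that by (auto simp: aclass_def intro: aeq.refl)
    then show ?thesis unfolding f_def using A.aeval_aeq[OF \<phi> E] by simp
  qed
  have 1: "f \<in> algebra_hom R (presented_algebra R X E) A"
    by (auto simp: algebra_hom_def hom_def ops I f A.aeval_closed[OF \<phi>])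
  have 2: "g (aclass R X E t) = f (aclass R X E t)"
    if g: "g \<in> algebra_hom R (presented_algebra R X E) A"
      and gx: "\<forall>x\<in>X. g (aclass R X E (AGen x)) = \<phi> x" and t: "t \<in> aterms R X" for g t
  proof -
    have g_add: "g (x \<oplus>\<^bsub>presented_algebra R X E\<^esub> y) = g x \<oplus> g y"
      and g_mult: "g (x \<otimes>\<^bsub>presented_algebra R X E\<^esub> y) = g x \<otimes> g y"
      and g_cl: "g x \<in> carrier A"
      if "x \<in> carrier (presented_algebra R X E)" "y \<in> carrier (presented_algebra R X E)" for x y
      using g that by (auto simp: algebra_hom_def hom_def)
    have g_smult: "g (a \<odot>\<^bsub>presented_algebra R X E\<^esub> x) = a \<odot> g x"
      if "a \<in> carrier R" "x \<in> carrier (presented_algebra R X E)" for a x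
      using g that by (auto simp: algebra_hom_def)
    have g_zero: "g \<zero>\<^bsub>presented_algebra R X E\<^esub> = \<zero>"
      using g_add[of "\<zero>\<^bsub>presented_algebra R X E\<^esub>" "\<zero>\<^bsub>presented_algebra R X E\<^esub>"]
        g_cl[of "\<zero>\<^bsub>presented_algebra R X E\<^esub>" "\<zero>\<^bsub>presented_algebra R X E\<^esub>"]
      by (metis A.M.add.l_cancel_one' P.M.l_zero P.M.zero_closed)
    have mem: "aclass R X E u \<in> carrier (presented_algebra R X E)" if "u \<in> aterms R X" for u
      using that by (simp add: ops)
    from t have "g (aclass R X E t) = aeval A \<phi> t"
    proof induction
      case (neg t)
      have "g (aclass R X E (ANeg t)) \<oplus> g (aclass R X E t)
        = g (aclass R X E (AAdd (ANeg t) t))"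
        using neg g_add[of "aclass R X E (ANeg t)" "aclass R X E t"] by (simp add: mem ops I)
      also have "aclass R X E (AAdd (ANeg t) t) = \<zero>\<^bsub>presented_algebra R X E\<^esub>"
        using neg by (simp add: ops I aclass_eq_iff aeq.add_neg)
      finally show ?case
        using neg g_cl mem[OF I(4)[OF neg(1)]] mem[OF neg(1)]
        by (metis A.M.minus_equality aeval.simps(4) g_zero)
    next
      case (add s t)
      then show ?case using g_add[of "aclass R X E s" "aclass R X E t"]
        by (simp add: mem ops)
    next
      case (smult a t)
      then show ?case using g_smult[of a "aclass R X E t"]
        by (simp add: mem ops)
    next
      case (mult s t)
      then show ?case using g_mult[of "aclass R X E s" "aclass R X E t"]
        by (simp add: mem ops)
    next
      case zero
      then show ?case using g_zero by (simp add: ops)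
    qed (simp add: gx)
    then show ?thesis using f[OF t] by simp
  qed
  from 1 2 show ?thesis by (intro bexI[of _ f]) (auto simp: f I ops)
qed


section \<open>Generalized Boolean dynamical systems\<close>

locale generalized_boolean_algebra = lattice B + weak_partial_order_bottom B for B (structure) +
  assumes meet_join_distrib: "\<lbrakk>x \<in> carrier B; y \<in> carrier B; z \<in> carrier B\<rbrakk> \<Longrightarrow>
      x \<sqinter> (y \<squnion> z) = (x \<sqinter> y) \<squnion> (x \<sqinter> z)"
    and relative_complement_exists: "\<lbrakk>x \<in> carrier B; y \<in> carrier B\<rbrakk> \<Longrightarrow>
      \<exists>z \<in> carrier B. z \<sqinter> y = \<bottom> \<and> z \<squnion> (x \<sqinter> y) = x"

definition rel_compl :: "('b, 'm) gorder_scheme \<Rightarrow> 'b \<Rightarrow> 'b \<Rightarrow> 'b"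
  where "rel_compl B x y =
    (THE z. z \<in> carrier B \<and> z \<sqinter>\<^bsub>B\<^esub> y = \<bottom>\<^bsub>B\<^esub> \<and> z \<squnion>\<^bsub>B\<^esub> (x \<sqinter>\<^bsub>B\<^esub> y) = x)"

lemma (in generalized_boolean_algebra) rel_compl:
  assumes x: "x \<in> carrier B" and y: "y \<in> carrier B"
  shows "rel_compl B x y \<in> carrier B" "rel_compl B x y \<sqinter> y = \<bottom>"
    "rel_compl B x y \<squnion> (x \<sqinter> y) = x"
proof -
  let ?P = "\<lambda>z. z \<in> carrier B \<and> z \<sqinter> y = \<bottom> \<and> z \<squnion> (x \<sqinter> y) = x"
  have le: "z \<sqsubseteq> w" if z: "?P z" and w: "?P w" for z w
  proof -
    have "z \<sqsubseteq> z \<sqinter> x" using z x y by (metis join_left le_refl meet_closed meet_le)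
    also have "z \<sqinter> x = (z \<sqinter> w) \<squnion> (z \<sqinter> (x \<sqinter> y))"
      using z w x y by (metis meet_closed meet_join_distrib)
    also have "\<dots> \<sqsubseteq> w"
    proof (rule join_le)
      show "z \<sqinter> w \<sqsubseteq> w" using z w by (simp add: meet_right)
      have "z \<sqinter> (x \<sqinter> y) \<sqsubseteq> z \<sqinter> y"
        using z x y by (meson le_trans meet_closed meet_le meet_left meet_right)
      also have "\<dots> \<sqsubseteq> w" using z w by simp
      finally show "z \<sqinter> (x \<sqinter> y) \<sqsubseteq> w" using z w x y by simp
    qed (use z w x y in auto)
    finally show ?thesis using z w x y by simp
  qed
  have "\<exists>!z. ?P z"
    using relative_complement_exists[OF x y] le by (blast intro: le_antisym)
  from theI'[OF this] show "rel_compl B x y \<in> carrier B" "rel_compl B x y \<sqinter> y = \<bottom>"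
    "rel_compl B x y \<squnion> (x \<sqinter> y) = x"
    unfolding rel_compl_def by auto
qed

definition gba_morphism ::
    "('b, 'm) gorder_scheme \<Rightarrow> ('c, 'n) gorder_scheme \<Rightarrow> ('b \<Rightarrow> 'c) \<Rightarrow> bool"
  where "gba_morphism B C f \<longleftrightarrow>
    f \<in> carrier B \<rightarrow> carrier C \<and> f \<bottom>\<^bsub>B\<^esub> = \<bottom>\<^bsub>C\<^esub> \<and>
    (\<forall>x \<in> carrier B. \<forall>y \<in> carrier B.
       f (x \<squnion>\<^bsub>B\<^esub> y) = f x \<squnion>\<^bsub>C\<^esub> f y \<and> f (x \<sqinter>\<^bsub>B\<^esub> y) = f x \<sqinter>\<^bsub>C\<^esub> f y \<and>
       f (rel_compl B x y) = rel_compl C (f x) (f y))"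

definition gba_ideal :: "('b, 'm) gorder_scheme \<Rightarrow> 'b set \<Rightarrow> bool"
  where "gba_ideal B J \<longleftrightarrow> J \<noteq> {} \<and> J \<subseteq> carrier B \<and>
    (\<forall>x \<in> J. \<forall>y \<in> J. x \<squnion>\<^bsub>B\<^esub> y \<in> J) \<and> (\<forall>x \<in> J. \<forall>y \<in> carrier B. x \<sqinter>\<^bsub>B\<^esub> y \<in> J)"

locale generalized_boolean_dynamical_system = generalized_boolean_algebra B
  for B :: "('b, 'm) gorder_scheme" (structure) +
  fixes L :: "'l set" and \<theta> :: "'l \<Rightarrow> 'b \<Rightarrow> 'b" and I :: "'l \<Rightarrow> 'b set"
  assumes action_morphism: "\<alpha> \<in> L \<Longrightarrow> gba_morphism B B (\<theta> \<alpha>)"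
    and ideal: "\<alpha> \<in> L \<Longrightarrow> gba_ideal B (I \<alpha>)"
    and range_in_ideal: "\<alpha> \<in> L \<Longrightarrow>
      {x \<in> carrier B. \<exists>y \<in> carrier B. x \<sqsubseteq> \<theta> \<alpha> y} \<subseteq> I \<alpha>"

definition gbds_delta ::
    "('b, 'm) gorder_scheme \<Rightarrow> 'l set \<Rightarrow> ('l \<Rightarrow> 'b \<Rightarrow> 'b) \<Rightarrow> 'b \<Rightarrow> 'l set"
  where "gbds_delta B L \<theta> x = {\<alpha> \<in> L. \<theta> \<alpha> x \<noteq> \<bottom>\<^bsub>B\<^esub>}"

definition gbds_reg :: "('b, 'm) gorder_scheme \<Rightarrow> 'l set \<Rightarrow> ('l \<Rightarrow> 'b \<Rightarrow> 'b) \<Rightarrow> 'b set"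
  where "gbds_reg B L \<theta> = {x \<in> carrier B. \<forall>y \<in> carrier B. y \<noteq> \<bottom>\<^bsub>B\<^esub> \<and> y \<sqsubseteq>\<^bsub>B\<^esub> x \<longrightarrow>
    finite (gbds_delta B L \<theta> y) \<and> 0 < card (gbds_delta B L \<theta> y)}"

datatype ('b, 'l) generator = GP 'b | GS 'l 'b | GSstar 'l 'b

abbreviation pp :: "'b \<Rightarrow> ('r, ('b, 'l) generator) aterm" where "pp x \<equiv> AGen (GP x)"
abbreviation ss :: "'l \<Rightarrow> 'b \<Rightarrow> ('r, ('b, 'l) generator) aterm" where "ss \<alpha> x \<equiv> AGen (GS \<alpha> x)"
abbreviation sstar :: "'l \<Rightarrow> 'b \<Rightarrow> ('r, ('b, 'l) generator) aterm"
  where "sstar \<alpha> x \<equiv> AGen (GSstar \<alpha> x)"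

definition gbds_generators ::
    "('b, 'm) gorder_scheme \<Rightarrow> 'l set \<Rightarrow> ('l \<Rightarrow> 'b set) \<Rightarrow> ('b, 'l) generator set"
  where "gbds_generators B L I =
    GP ` carrier B \<union> {GS \<alpha> x | \<alpha> x. \<alpha> \<in> L \<and> x \<in> I \<alpha>} \<union> {GSstar \<alpha> x | \<alpha> x. \<alpha> \<in> L \<and> x \<in> I \<alpha>}"

text \<open>In rule \<open>cuntz_krieger\<close> the finite sum over \<open>\<Delta>\<^sub>x\<close> is taken along an enumeration \<open>\<alpha>s\<close> of
  \<open>\<Delta>\<^sub>x\<close>; there is one relation for each enumeration, but they are all equivalent because addition
  is commutative.\<close>

inductive_set gbds_relations ::
    "('b, 'm) gorder_scheme \<Rightarrow> 'l set \<Rightarrow> ('l \<Rightarrow> 'b \<Rightarrow> 'b) \<Rightarrow> ('l \<Rightarrow> 'b set) \<Rightarrow>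
     (('r, ('b, 'l) generator) aterm \<times> ('r, ('b, 'l) generator) aterm) set"
  for B :: "('b, 'm) gorder_scheme" (structure)
    and L :: "'l set" and \<theta> :: "'l \<Rightarrow> 'b \<Rightarrow> 'b" and I :: "'l \<Rightarrow> 'b set" where
  p_empty: "(pp \<bottom>, AZero) \<in> gbds_relations B L \<theta> I"
| p_meet: "\<lbrakk>x \<in> carrier B; y \<in> carrier B\<rbrakk> \<Longrightarrow>
    (pp (x \<sqinter> y), AMult (pp x) (pp y)) \<in> gbds_relations B L \<theta> I"
| p_join: "\<lbrakk>x \<in> carrier B; y \<in> carrier B\<rbrakk> \<Longrightarrow>
    (pp (x \<squnion> y), AAdd (AAdd (pp x) (pp y)) (ANeg (pp (x \<sqinter> y)))) \<in> gbds_relations B L \<theta> I"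
| p_s: "\<lbrakk>x \<in> carrier B; \<alpha> \<in> L; y \<in> I \<alpha>\<rbrakk> \<Longrightarrow>
    (AMult (pp x) (ss \<alpha> y), AMult (ss \<alpha> y) (pp (\<theta> \<alpha> x))) \<in> gbds_relations B L \<theta> I"
| sstar_p: "\<lbrakk>x \<in> carrier B; \<alpha> \<in> L; y \<in> I \<alpha>\<rbrakk> \<Longrightarrow>
    (AMult (sstar \<alpha> y) (pp x), AMult (pp (\<theta> \<alpha> x)) (sstar \<alpha> y)) \<in> gbds_relations B L \<theta> I"
| sstar_s: "\<lbrakk>\<alpha> \<in> L; y \<in> I \<alpha>; \<alpha>' \<in> L; y' \<in> I \<alpha>'\<rbrakk> \<Longrightarrow>
    (AMult (sstar \<alpha> y) (ss \<alpha>' y'), if \<alpha> = \<alpha>' then pp (y \<sqinter> y') else AZero)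
      \<in> gbds_relations B L \<theta> I"
| s_p: "\<lbrakk>\<alpha> \<in> L; y \<in> I \<alpha>; y' \<in> carrier B\<rbrakk> \<Longrightarrow>
    (AMult (ss \<alpha> y) (pp y'), ss \<alpha> (y \<sqinter> y')) \<in> gbds_relations B L \<theta> I"
| p_sstar: "\<lbrakk>\<alpha> \<in> L; y \<in> I \<alpha>; y' \<in> carrier B\<rbrakk> \<Longrightarrow>
    (AMult (pp y') (sstar \<alpha> y), sstar \<alpha> (y \<sqinter> y')) \<in> gbds_relations B L \<theta> I"
| cuntz_krieger: "\<lbrakk>x \<in> gbds_reg B L \<theta>; distinct \<alpha>s; set \<alpha>s = gbds_delta B L \<theta> x\<rbrakk> \<Longrightarrow>
    (pp x, ASum (map (\<lambda>\<alpha>. AMult (ss \<alpha> (\<theta> \<alpha> x)) (sstar \<alpha> (\<theta> \<alpha> x))) \<alpha>s))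
      \<in> gbds_relations B L \<theta> I"

definition gbds_algebra ::
    "('r, 'k) ring_scheme \<Rightarrow> ('b, 'm) gorder_scheme \<Rightarrow> 'l set \<Rightarrow> ('l \<Rightarrow> 'b \<Rightarrow> 'b) \<Rightarrow>
     ('l \<Rightarrow> 'b set) \<Rightarrow> ('r, ('r, ('b, 'l) generator) aterm set) module"
  where "gbds_algebra R B L \<theta> I =
    presented_algebra R (gbds_generators B L I) (gbds_relations B L \<theta> I)"


section \<open>Generalized labelled spaces\<close>

text \<open>The source and range maps of the directed graph \<open>G\<close> are \<open>tail G\<close> and \<open>head G\<close>.\<close>

locale labelled_graph = wf_digraph G for G :: "('v, 'e) pre_digraph" +
  fixes L :: "'l set" and lab :: "'e \<Rightarrow> 'l"
  assumes label_in_alphabet: "e \<in> arcs G \<Longrightarrow> lab e \<in> L"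

definition rel_range :: "('v, 'e) pre_digraph \<Rightarrow> ('e \<Rightarrow> 'l) \<Rightarrow> 'v set \<Rightarrow> 'l \<Rightarrow> 'v set"
  where "rel_range G lab A a =
    {v \<in> verts G. \<exists>e \<in> arcs G. lab e = a \<and> tail G e \<in> A \<and> head G e = v}"

locale labelled_space = labelled_graph G L lab
  for G :: "('v, 'e) pre_digraph" and L :: "'l set" and lab :: "'e \<Rightarrow> 'l" +
  fixes \<B> :: "'v set set"
  assumes subsets_of_verts: "A \<in> \<B> \<Longrightarrow> A \<subseteq> verts G"
    and empty_closed: "{} \<in> \<B>"
    and union_closed: "\<lbrakk>A \<in> \<B>; B \<in> \<B>\<rbrakk> \<Longrightarrow> A \<union> B \<in> \<B>"
    and inter_closed: "\<lbrakk>A \<in> \<B>; B \<in> \<B>\<rbrakk> \<Longrightarrow> A \<inter> B \<in> \<B>"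
    and range_closed: "\<lbrakk>A \<in> \<B>; a \<in> L\<rbrakk> \<Longrightarrow> rel_range G lab A a \<in> \<B>"

locale normal_labelled_space = labelled_space +
  assumes diff_closed: "\<lbrakk>A \<in> \<B>; B \<in> \<B>\<rbrakk> \<Longrightarrow> A - B \<in> \<B>"

locale weakly_left_resolving_labelled_space = labelled_space +
  assumes weakly_left_resolving: "\<lbrakk>A \<in> \<B>; B \<in> \<B>; a \<in> L\<rbrakk> \<Longrightarrow>
    rel_range G lab (A \<inter> B) a = rel_range G lab A a \<inter> rel_range G lab B a"

definition set_ideal :: "'v set set \<Rightarrow> 'v set set \<Rightarrow> bool"
  where "set_ideal \<B> J \<longleftrightarrow> J \<noteq> {} \<and> J \<subseteq> \<B> \<and>
    (\<forall>A \<in> J. \<forall>B \<in> J. A \<union> B \<in> J) \<and> (\<forall>A \<in> J. \<forall>B \<in> \<B>. A \<inter> B \<in> J)"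

locale generalized_labelled_space =
  normal_labelled_space G L lab \<B> + weakly_left_resolving_labelled_space G L lab \<B>
  for G :: "('v, 'e) pre_digraph" and L :: "'l set" and lab :: "'e \<Rightarrow> 'l" and \<B> :: "'v set set" +
  fixes I :: "'l \<Rightarrow> 'v set set"
  assumes ideal: "a \<in> L \<Longrightarrow> set_ideal \<B> (I a)"
    and range_in_ideal: "a \<in> L \<Longrightarrow> {A \<in> \<B>. \<exists>B \<in> \<B>. A \<subseteq> rel_range G lab B a} \<subseteq> I a"

definition gls_delta ::
    "('v, 'e) pre_digraph \<Rightarrow> 'l set \<Rightarrow> ('e \<Rightarrow> 'l) \<Rightarrow> 'v set \<Rightarrow> 'l set"
  where "gls_delta G L lab A = {a \<in> L. rel_range G lab A a \<noteq> {}}"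

definition gls_reg ::
    "('v, 'e) pre_digraph \<Rightarrow> 'l set \<Rightarrow> ('e \<Rightarrow> 'l) \<Rightarrow> 'v set set \<Rightarrow> 'v set set"
  where "gls_reg G L lab \<B> = {A \<in> \<B>. \<forall>B \<in> \<B>. B \<noteq> {} \<and> B \<subseteq> A \<longrightarrow>
    finite (gls_delta G L lab B) \<and> 0 < card (gls_delta G L lab B)}"

definition gls_generators ::
    "'l set \<Rightarrow> 'v set set \<Rightarrow> ('l \<Rightarrow> 'v set set) \<Rightarrow> ('v set, 'l) generator set"
  where "gls_generators L \<B> I =
    GP ` \<B> \<union> {GS a A | a A. a \<in> L \<and> A \<in> I a} \<union> {GSstar a A | a A. a \<in> L \<and> A \<in> I a}"

inductive_set gls_relations ::
    "('v, 'e) pre_digraph \<Rightarrow> 'l set \<Rightarrow> ('e \<Rightarrow> 'l) \<Rightarrow> 'v set set \<Rightarrow> ('l \<Rightarrow> 'v set set) \<Rightarrow>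
     (('r, ('v set, 'l) generator) aterm \<times> ('r, ('v set, 'l) generator) aterm) set"
  for G :: "('v, 'e) pre_digraph" and L :: "'l set" and lab :: "'e \<Rightarrow> 'l"
    and \<B> :: "'v set set" and I :: "'l \<Rightarrow> 'v set set" where
  p_empty: "(pp {}, AZero) \<in> gls_relations G L lab \<B> I"
| p_inter: "\<lbrakk>A \<in> \<B>; B \<in> \<B>\<rbrakk> \<Longrightarrow>
    (pp (A \<inter> B), AMult (pp A) (pp B)) \<in> gls_relations G L lab \<B> I"
| p_union: "\<lbrakk>A \<in> \<B>; B \<in> \<B>\<rbrakk> \<Longrightarrow>
    (pp (A \<union> B), AAdd (AAdd (pp A) (pp B)) (ANeg (pp (A \<inter> B)))) \<in> gls_relations G L lab \<B> I"
| p_s: "\<lbrakk>B \<in> \<B>; a \<in> L; A \<in> I a\<rbrakk> \<Longrightarrow>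
    (AMult (pp B) (ss a A), AMult (ss a A) (pp (rel_range G lab B a))) \<in> gls_relations G L lab \<B> I"
| sstar_p: "\<lbrakk>B \<in> \<B>; a \<in> L; A \<in> I a\<rbrakk> \<Longrightarrow>
    (AMult (sstar a A) (pp B), AMult (pp (rel_range G lab B a)) (sstar a A))
      \<in> gls_relations G L lab \<B> I"
| sstar_s: "\<lbrakk>a \<in> L; A \<in> I a; a' \<in> L; A' \<in> I a'\<rbrakk> \<Longrightarrow>
    (AMult (sstar a A) (ss a' A'), if a = a' then pp (A \<inter> A') else AZero)
      \<in> gls_relations G L lab \<B> I"
| s_p: "\<lbrakk>a \<in> L; A \<in> I a; B \<in> \<B>\<rbrakk> \<Longrightarrow>
    (AMult (ss a A) (pp B), ss a (A \<inter> B)) \<in> gls_relations G L lab \<B> I"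
| p_sstar: "\<lbrakk>a \<in> L; A \<in> I a; B \<in> \<B>\<rbrakk> \<Longrightarrow>
    (AMult (pp B) (sstar a A), sstar a (A \<inter> B)) \<in> gls_relations G L lab \<B> I"
| cuntz_krieger: "\<lbrakk>A \<in> gls_reg G L lab \<B>; distinct as; set as = gls_delta G L lab A\<rbrakk> \<Longrightarrow>
    (pp A, ASum (map (\<lambda>a. AMult (ss a (rel_range G lab A a)) (sstar a (rel_range G lab A a))) as))
      \<in> gls_relations G L lab \<B> I"

definition gls_algebra ::
    "('r, 'k) ring_scheme \<Rightarrow> ('v, 'e) pre_digraph \<Rightarrow> 'l set \<Rightarrow> ('e \<Rightarrow> 'l) \<Rightarrow> 'v set set \<Rightarrow>
     ('l \<Rightarrow> 'v set set) \<Rightarrow> ('r, ('r, ('v set, 'l) generator) aterm set) module"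
  where "gls_algebra R G L lab \<B> I =
    presented_algebra R (gls_generators L \<B> I) (gls_relations G L lab \<B> I)"

end

theory Submission
  imports Defs
begin

text \<open>
  A labelled space is a Boolean dynamical system of sets. If \<open>\<B>\<close> is a normal accommodating family of a
  weakly left-resolving labelled graph, then \<open>\<B>\<close> ordered by inclusion is a generalized Boolean algebra
  and relative ranges \<open>A \<mapsto> r(A, a)\<close> are morphisms of it: they preserve unions by definition and
  intersections by hypothesis, hence also differences. The generators and relations of the two
  algebras are then the same, so the algebras are equal (\<open>gbds_algebra_eq\<close>).

  Conversely, every Boolean dynamical system is isomorphic to one that arises from a labelled space,
  by Stone duality. Represent \<open>x\<close> by the set \<open>Z(x)\<close> of the prime filters that contain it. The map \<open>Z\<close>
  preserves all operations, and it is injective because every nonzero element lies in a prime filter.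
  Take the prime filters as vertices, and for every prime filter \<open>\<eta>\<close> and every letter \<open>\<alpha>\<close> draw an
  edge labelled \<open>\<alpha>\<close> from the preimage of \<open>\<eta>\<close> under \<open>\<theta>\<^sub>\<alpha>\<close> to \<open>\<eta>\<close>, provided that this preimage is
  nonempty (it is then a prime filter). The relative range of \<open>Z(x)\<close> with respect to \<open>\<alpha>\<close> consists of
  all \<open>\<eta>\<close> that contain \<open>\<theta>\<^sub>\<alpha>(x)\<close>, that is, it equals \<open>Z(\<theta>\<^sub>\<alpha>(x))\<close> (\<open>rel_range_stone\<close>). Thus the sets \<open>Z(x)\<close>
  form a labelled space, and \<open>Z\<close> is an isomorphism from the given system onto the system of this
  labelled space (\<open>stone_gbds_iso\<close>). Isomorphic systems have isomorphic algebras, because an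
  isomorphism only renames the generators of the presentation (\<open>gbds_iso.algebra_isomorphic\<close>).
\<close>

section \<open>Renaming generators of a presented algebra\<close>

lemma algebra_hom_id: "(\<lambda>x. x) \<in> algebra_hom R A A"
  by (auto simp: algebra_hom_def hom_def)

lemma algebra_hom_compose:
  assumes "f \<in> algebra_hom R A C" "g \<in> algebra_hom R C D"
  shows "g \<circ> f \<in> algebra_hom R A D"
  using assms by (auto simp: algebra_hom_def hom_def Pi_iff)

lemma algebra_isomorphic_trans:
  assumes "algebra_isomorphic R A C" "algebra_isomorphic R C D"
  shows "algebra_isomorphic R A D"
  using assms unfolding algebra_isomorphic_def
  by (meson algebra_hom_compose bij_betw_trans)

lemma map_aterm_in_aterms:
  assumes "t \<in> aterms R X" "f \<in> X \<rightarrow> Y"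
  shows "map_aterm id f t \<in> aterms R Y"
  using assms(1) by induction (use assms(2) in \<open>auto intro: aterms.intros\<close>)

lemma map_aterm_ASum: "map_aterm u f (ASum ts) = ASum (map (map_aterm u f) ts)"
  by (induction ts) (auto simp: ASum_def)

lemma aeval_map_aterm: "aeval A \<phi> (map_aterm id f t) = aeval A (\<phi> \<circ> f) t"
  by (induction t) auto

lemma presented_algebra_rename_hom:
  assumes R: "cring R" and f: "f \<in> X \<rightarrow> Y"
    and E: "\<And>s t. (s, t) \<in> E \<Longrightarrow> (map_aterm id f s, map_aterm id f t) \<in> F"
  obtains h where "h \<in> algebra_hom R (presented_algebra R X E) (presented_algebra R Y F)"
    and "\<And>x. x \<in> X \<Longrightarrow> h (aclass R X E (AGen x)) = aclass R Y F (AGen (f x))"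
proof -
  let ?\<psi> = "\<lambda>y. aclass R Y F (AGen y)"
  have gen: "?\<psi> \<circ> f \<in> X \<rightarrow> carrier (presented_algebra R Y F)"
    using f by (auto simp: presented_algebra_def intro!: imageI aterms.gen)
  have rel: "aeval (presented_algebra R Y F) (?\<psi> \<circ> f) s = aeval (presented_algebra R Y F) (?\<psi> \<circ> f) t"
    if "(s, t) \<in> E" "s \<in> aterms R X" "t \<in> aterms R X" for s t
    using presented_algebra_relations[OF R E[OF that(1)] map_aterm_in_aterms[OF that(2) f]
        map_aterm_in_aterms[OF that(3) f]]
    by (simp only: aeval_map_aterm)
  obtain h where "h \<in> algebra_hom R (presented_algebra R X E) (presented_algebra R Y F)"
    and "\<forall>x\<in>X. h (aclass R X E (AGen x)) = (?\<psi> \<circ> f) x"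
    by (rule bexE[OF presented_algebra_universal[OF presented_algebra_is_algebra[OF R] gen rel]])
      (assumption+, erule conjE, rule that)
  then show thesis by (intro that[of h]) simp_all
qed

lemma presented_algebra_endomorphism_eq_id:
  assumes R: "cring R" and g: "g \<in> algebra_hom R (presented_algebra R X E) (presented_algebra R X E)"
    and gen: "\<And>x. x \<in> X \<Longrightarrow> g (aclass R X E (AGen x)) = aclass R X E (AGen x)"
    and u: "u \<in> carrier (presented_algebra R X E)"
  shows "g u = u"
proof -
  let ?\<psi> = "\<lambda>x. aclass R X E (AGen x)"
  have "?\<psi> \<in> X \<rightarrow> carrier (presented_algebra R X E)"
    by (auto simp: presented_algebra_def intro!: imageI aterms.gen)
  from presented_algebra_universal[OF presented_algebra_is_algebra[OF R] this, of E,
      OF presented_algebra_relations[OF R]]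
  obtain f where "\<forall>h \<in> algebra_hom R (presented_algebra R X E) (presented_algebra R X E).
      (\<forall>x\<in>X. h (?\<psi> x) = ?\<psi> x) \<longrightarrow> (\<forall>u \<in> carrier (presented_algebra R X E). h u = f u)"
    by auto
  then have "h u = f u" if "h \<in> algebra_hom R (presented_algebra R X E) (presented_algebra R X E)"
      "\<forall>x\<in>X. h (?\<psi> x) = ?\<psi> x" for h
    using that u by blast
  from this[OF g] this[OF algebra_hom_id] show ?thesis
    using gen by simp
qed

text \<open>Mutually inverse renamings of generators that carry relations to relations induce mutually inverse
  homomorphisms, by uniqueness in the universal property.\<close>

lemma presented_algebra_isomorphic:
  assumes R: "cring R" and f: "f \<in> X \<rightarrow> Y" and g: "g \<in> Y \<rightarrow> X"
    and gf: "\<And>x. x \<in> X \<Longrightarrow> g (f x) = x" and fg: "\<And>y. y \<in> Y \<Longrightarrow> f (g y) = y"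
    and E: "\<And>s t. (s, t) \<in> E \<Longrightarrow> (map_aterm id f s, map_aterm id f t) \<in> F"
    and F: "\<And>s t. (s, t) \<in> F \<Longrightarrow> (map_aterm id g s, map_aterm id g t) \<in> E"
  shows "algebra_isomorphic R (presented_algebra R X E) (presented_algebra R Y F)"
proof -
  let ?P = "presented_algebra R X E" and ?Q = "presented_algebra R Y F"
  obtain h where h: "h \<in> algebra_hom R ?P ?Q"
    and h_gen: "\<And>x. x \<in> X \<Longrightarrow> h (aclass R X E (AGen x)) = aclass R Y F (AGen (f x))"
    using presented_algebra_rename_hom[OF R f, of E F] E by blast
  obtain k where k: "k \<in> algebra_hom R ?Q ?P"
    and k_gen: "\<And>y. y \<in> Y \<Longrightarrow> k (aclass R Y F (AGen y)) = aclass R X E (AGen (g y))"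
    using presented_algebra_rename_hom[OF R g, of F E] F by blast
  have "(k \<circ> h) u = u" if "u \<in> carrier ?P" for u
    by (rule presented_algebra_endomorphism_eq_id[OF R algebra_hom_compose[OF h k] _ that])
      (simp add: h_gen k_gen gf funcset_mem[OF f])
  moreover have "(h \<circ> k) u = u" if "u \<in> carrier ?Q" for u
    by (rule presented_algebra_endomorphism_eq_id[OF R algebra_hom_compose[OF k h] _ that])
      (simp add: h_gen k_gen fg funcset_mem[OF g])
  moreover have "h \<in> carrier ?P \<rightarrow> carrier ?Q" "k \<in> carrier ?Q \<rightarrow> carrier ?P"
    using h k by (auto simp: algebra_hom_def hom_def)
  ultimately have "bij_betw h (carrier ?P) (carrier ?Q)"
    by (intro bij_betwI[of _ _ _ k]) auto
  with h show ?thesis unfolding algebra_isomorphic_def by blast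
qed


section \<open>Isomorphic Boolean dynamical systems\<close>

text \<open>An isomorphism of systems with the same alphabet: a bijection of the Boolean algebras that
  preserves bottom, joins and meets, intertwines the actions and matches the ideals. It then
  preserves the order and relative complements as well.\<close>

locale gbds_iso =
  D: generalized_boolean_dynamical_system B L \<theta> I +
  D': generalized_boolean_dynamical_system B' L \<theta>' I'
  for B :: "('b, 'm) gorder_scheme" and L :: "'l set" and \<theta> I
    and B' :: "('c, 'n) gorder_scheme" and \<theta>' I' +
  fixes h :: "'b \<Rightarrow> 'c"
  assumes bij: "bij_betw h (carrier B) (carrier B')"
    and bottom: "h \<bottom>\<^bsub>B\<^esub> = \<bottom>\<^bsub>B'\<^esub>"
    and join: "\<lbrakk>x \<in> carrier B; y \<in> carrier B\<rbrakk> \<Longrightarrow> h (x \<squnion>\<^bsub>B\<^esub> y) = h x \<squnion>\<^bsub>B'\<^esub> h y"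
    and meet: "\<lbrakk>x \<in> carrier B; y \<in> carrier B\<rbrakk> \<Longrightarrow> h (x \<sqinter>\<^bsub>B\<^esub> y) = h x \<sqinter>\<^bsub>B'\<^esub> h y"
    and action: "\<lbrakk>\<alpha> \<in> L; x \<in> carrier B\<rbrakk> \<Longrightarrow> h (\<theta> \<alpha> x) = \<theta>' \<alpha> (h x)"
    and ideal_image: "\<alpha> \<in> L \<Longrightarrow> h ` I \<alpha> = I' \<alpha>"

context generalized_boolean_dynamical_system
begin

lemma action_closed: "\<lbrakk>\<alpha> \<in> L; x \<in> carrier B\<rbrakk> \<Longrightarrow> \<theta> \<alpha> x \<in> carrier B"
  using action_morphism[of \<alpha>] by (auto simp: gba_morphism_def)

lemma ideal_subset: "\<alpha> \<in> L \<Longrightarrow> I \<alpha> \<subseteq> carrier B"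
  using ideal by (auto simp: gba_ideal_def)

end

context gbds_iso
begin

lemma closed: "x \<in> carrier B \<Longrightarrow> h x \<in> carrier B'"
  using bij by (rule bij_betw_apply)

lemma in_ideal: "\<lbrakk>\<alpha> \<in> L; x \<in> I \<alpha>\<rbrakk> \<Longrightarrow> h x \<in> I' \<alpha>"
  using ideal_image by blast

lemma eq_bottom_iff: "x \<in> carrier B \<Longrightarrow> h x = \<bottom>\<^bsub>B'\<^esub> \<longleftrightarrow> x = \<bottom>\<^bsub>B\<^esub>"
  using bij bottom D.bottom_closed by (metis bij_betw_imp_inj_on inj_on_eq_iff)

lemma le_iff:
  assumes "x \<in> carrier B" "y \<in> carrier B"
  shows "h x \<sqsubseteq>\<^bsub>B'\<^esub> h y \<longleftrightarrow> x \<sqsubseteq>\<^bsub>B\<^esub> y"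
proof -
  have "h x \<sqsubseteq>\<^bsub>B'\<^esub> h y \<longleftrightarrow> h x = h (x \<sqinter>\<^bsub>B\<^esub> y)"
    using assms by (simp add: D'.le_iff_join closed meet)
  also have "\<dots> \<longleftrightarrow> x = x \<sqinter>\<^bsub>B\<^esub> y"
    using assms bij_betw_imp_inj_on[OF bij] by (simp add: inj_on_eq_iff)
  finally show ?thesis using assms by (simp add: D.le_iff_join)
qed

lemma delta: "x \<in> carrier B \<Longrightarrow> gbds_delta B' L \<theta>' (h x) = gbds_delta B L \<theta> x"
  using eq_bottom_iff D.action_closed by (auto simp: gbds_delta_def simp flip: action)

lemma reg:
  assumes "x \<in> gbds_reg B L \<theta>"
  shows "h x \<in> gbds_reg B' L \<theta>'"
proof -
  have x: "x \<in> carrier B" using assms by (simp add: gbds_reg_def)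
  have "finite (gbds_delta B' L \<theta>' y') \<and> 0 < card (gbds_delta B' L \<theta>' y')"
    if y': "y' \<in> carrier B'" "y' \<noteq> \<bottom>\<^bsub>B'\<^esub>" "y' \<sqsubseteq>\<^bsub>B'\<^esub> h x" for y'
  proof -
    obtain y where y: "y \<in> carrier B" "y' = h y"
      using y'(1) bij by (auto simp: bij_betw_def)
    then have "y \<noteq> \<bottom>\<^bsub>B\<^esub>" "y \<sqsubseteq>\<^bsub>B\<^esub> x"
      using y' x by (auto simp: le_iff eq_bottom_iff)
    then show ?thesis using assms y by (simp add: delta gbds_reg_def)
  qed
  then show ?thesis using x by (auto simp: gbds_reg_def closed)
qed

lemma generators: "map_generator h id \<in> gbds_generators B L I \<rightarrow> gbds_generators B' L I'"
  by (auto simp: gbds_generators_def closed in_ideal)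

lemma relations:
  assumes "(s, t) \<in> gbds_relations B L \<theta> I"
  shows "(map_aterm id (map_generator h id) s, map_aterm id (map_generator h id) t)
    \<in> gbds_relations B' L \<theta>' I'"
  using assms
proof cases
  case p_empty
  then show ?thesis by (simp add: bottom gbds_relations.p_empty)
next
  case (cuntz_krieger x \<alpha>s)
  then have x: "x \<in> carrier B" by (simp add: gbds_reg_def)
  have "h (\<theta> \<alpha> x) = \<theta>' \<alpha> (h x)" if "\<alpha> \<in> set \<alpha>s" for \<alpha>
    using that cuntz_krieger x by (simp add: action gbds_delta_def)
  then have "map (\<lambda>\<alpha>. AMult (ss \<alpha> (h (\<theta> \<alpha> x))) (sstar \<alpha> (h (\<theta> \<alpha> x)))) \<alpha>s =
      map (\<lambda>\<alpha>. AMult (ss \<alpha> (\<theta>' \<alpha> (h x))) (sstar \<alpha> (\<theta>' \<alpha> (h x)))) \<alpha>s"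
    by (intro map_cong) auto
  note * = this
  \<comment> \<open>An enumeration of the letters that act nontrivially on \<open>x\<close> also serves for \<open>h x\<close>.\<close>
  have "(pp (h x), ASum (map (\<lambda>\<alpha>. AMult (ss \<alpha> (\<theta>' \<alpha> (h x))) (sstar \<alpha> (\<theta>' \<alpha> (h x)))) \<alpha>s))
      \<in> gbds_relations B' L \<theta>' I'"
    using cuntz_krieger x by (intro gbds_relations.cuntz_krieger reg) (simp_all add: delta)
  then show ?thesis
    unfolding cuntz_krieger(1,2) by (simp add: map_aterm_ASum comp_def * del: map_eq_conv)
next
  case (sstar_s \<alpha> y \<alpha>' y')
  then show ?thesis
    using gbds_relations.sstar_s[of \<alpha> L "h y" I' \<alpha>' "h y'" B' \<theta>'] D.ideal_subset in_ideal
    by (auto simp: meet subset_iff split: if_splits)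
qed (use D.ideal_subset in \<open>auto simp: join meet action subset_iff
    intro: gbds_relations.p_meet gbds_relations.p_join gbds_relations.p_s gbds_relations.sstar_p
      gbds_relations.s_p gbds_relations.p_sstar closed in_ideal\<close>)

lemma inverse: "gbds_iso B' L \<theta>' I' B \<theta> I (the_inv_into (carrier B) h)"
proof -
  let ?k = "the_inv_into (carrier B) h"
  have inj: "inj_on h (carrier B)" and img: "h ` carrier B = carrier B'"
    using bij by (auto simp: bij_betw_def)
  have k: "?k (h x) = x" if "x \<in> carrier B" for x
    using inj that by (rule the_inv_into_f_f)
  have ex: "\<exists>x \<in> carrier B. y = h x" if "y \<in> carrier B'" for y
    using img that by auto
  show ?thesis
  proof
    show "bij_betw ?k (carrier B') (carrier B)" using bij by (rule bij_betw_the_inv_into)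
    show "?k \<bottom>\<^bsub>B'\<^esub> = \<bottom>\<^bsub>B\<^esub>" using k[OF D.bottom_closed] by (simp add: bottom)
    show "?k (x \<squnion>\<^bsub>B'\<^esub> y) = ?k x \<squnion>\<^bsub>B\<^esub> ?k y" if "x \<in> carrier B'" "y \<in> carrier B'" for x y
      using ex[OF that(1)] ex[OF that(2)] by (auto simp: k simp flip: join)
    show "?k (x \<sqinter>\<^bsub>B'\<^esub> y) = ?k x \<sqinter>\<^bsub>B\<^esub> ?k y" if "x \<in> carrier B'" "y \<in> carrier B'" for x y
      using ex[OF that(1)] ex[OF that(2)] by (auto simp: k simp flip: meet)
    show "?k (\<theta>' \<alpha> x) = \<theta> \<alpha> (?k x)" if "\<alpha> \<in> L" "x \<in> carrier B'" for \<alpha> x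
      using ex[OF that(2)] that(1) by (auto simp: k D.action_closed simp flip: action)
    show "?k ` I' \<alpha> = I \<alpha>" if "\<alpha> \<in> L" for \<alpha>
    proof -
      have "?k ` h ` I \<alpha> = I \<alpha>"
        unfolding image_image using k D.ideal_subset[OF that] by (force simp: subset_iff)
      then show ?thesis using ideal_image[OF that] by simp
    qed
  qed
qed

lemma algebra_isomorphic:
  assumes "cring R"
  shows "algebra_isomorphic R (gbds_algebra R B L \<theta> I) (gbds_algebra R B' L \<theta>' I')"
proof -
  let ?k = "the_inv_into (carrier B) h"
  interpret inv: gbds_iso B' L \<theta>' I' B \<theta> I ?k by (rule inverse)
  have inj: "inj_on h (carrier B)" and img: "h ` carrier B = carrier B'"
    using bij by (auto simp: bij_betw_def)
  have kh: "?k (h x) = x" if "x \<in> carrier B" for x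
    using inj that by (rule the_inv_into_f_f)
  have hk: "h (?k x) = x" if "x \<in> carrier B'" for x
    using inj that img by (simp add: f_the_inv_into_f)
  show ?thesis
    unfolding gbds_algebra_def
  proof (rule presented_algebra_isomorphic[OF assms generators inv.generators])
    show "map_generator ?k id (map_generator h id x) = x" if "x \<in> gbds_generators B L I" for x
      using that kh D.ideal_subset by (auto simp: gbds_generators_def subset_iff)
    show "map_generator h id (map_generator ?k id x) = x" if "x \<in> gbds_generators B' L I'" for x
      using that hk D'.ideal_subset by (auto simp: gbds_generators_def subset_iff)
  qed (fact relations inv.relations)+
qed

end


section \<open>The Boolean dynamical system of a labelled space\<close>

text \<open>A family of sets, ordered by inclusion.\<close>

definition set_gorder :: "'v set set \<Rightarrow> 'v set gorder"
  where "set_gorder \<B> = \<lparr>carrier = \<B>, eq = (=), le = (\<subseteq>)\<rparr>"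

lemma set_gorder_simps [simp]:
  "carrier (set_gorder \<B>) = \<B>" "le (set_gorder \<B>) = (\<subseteq>)" "eq (set_gorder \<B>) = (=)"
  by (simp_all add: set_gorder_def)

text \<open>A ring of sets, not necessarily covering the ground type and not necessarily containing a
  largest set.\<close>

locale set_ring =
  fixes \<B> :: "'v set set"
  assumes empty: "{} \<in> \<B>"
    and union: "\<lbrakk>A \<in> \<B>; B \<in> \<B>\<rbrakk> \<Longrightarrow> A \<union> B \<in> \<B>"
    and inter: "\<lbrakk>A \<in> \<B>; B \<in> \<B>\<rbrakk> \<Longrightarrow> A \<inter> B \<in> \<B>"
    and diff: "\<lbrakk>A \<in> \<B>; B \<in> \<B>\<rbrakk> \<Longrightarrow> A - B \<in> \<B>"
begin

lemma least_union: "\<lbrakk>A \<in> \<B>; B \<in> \<B>\<rbrakk> \<Longrightarrow> least (set_gorder \<B>) (A \<union> B) (Upper (set_gorder \<B>) {A, B})"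
  by (auto simp: least_def Upper_def union)

lemma greatest_inter: "\<lbrakk>A \<in> \<B>; B \<in> \<B>\<rbrakk> \<Longrightarrow> greatest (set_gorder \<B>) (A \<inter> B) (Lower (set_gorder \<B>) {A, B})"
  by (auto simp: greatest_def Lower_def inter)

sublocale S: lattice "set_gorder \<B>"
proof
  show "\<exists>C. least (set_gorder \<B>) C (Upper (set_gorder \<B>) {A, B})"
    if "A \<in> carrier (set_gorder \<B>)" "B \<in> carrier (set_gorder \<B>)" for A B
    using that least_union by auto
  show "\<exists>C. greatest (set_gorder \<B>) C (Lower (set_gorder \<B>) {A, B})"
    if "A \<in> carrier (set_gorder \<B>)" "B \<in> carrier (set_gorder \<B>)" for A B
    using that greatest_inter by auto
qed auto

lemma join_eq: "\<lbrakk>A \<in> \<B>; B \<in> \<B>\<rbrakk> \<Longrightarrow> A \<squnion>\<^bsub>set_gorder \<B>\<^esub> B = A \<union> B"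
  by (rule S.joinI) (simp_all add: S.least_unique[OF _ least_union])

lemma meet_eq: "\<lbrakk>A \<in> \<B>; B \<in> \<B>\<rbrakk> \<Longrightarrow> A \<sqinter>\<^bsub>set_gorder \<B>\<^esub> B = A \<inter> B"
  by (rule S.meetI) (simp_all add: S.greatest_unique[OF _ greatest_inter])

sublocale S: weak_partial_order_bottom "set_gorder \<B>"
  using empty by unfold_locales (auto simp: least_def)

lemma bottom_eq: "\<bottom>\<^bsub>set_gorder \<B>\<^esub> = {}"
  using S.bottom_lower[of "{}"] empty by simp

sublocale S: generalized_boolean_algebra "set_gorder \<B>"
proof
  show "\<exists>C \<in> carrier (set_gorder \<B>). C \<sqinter>\<^bsub>set_gorder \<B>\<^esub> B = \<bottom>\<^bsub>set_gorder \<B>\<^esub> \<and>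
      C \<squnion>\<^bsub>set_gorder \<B>\<^esub> (A \<sqinter>\<^bsub>set_gorder \<B>\<^esub> B) = A"
    if "A \<in> carrier (set_gorder \<B>)" "B \<in> carrier (set_gorder \<B>)" for A B
    using that by (intro bexI[of _ "A - B"]) (auto simp: join_eq meet_eq bottom_eq inter diff)
qed (auto simp: join_eq meet_eq union inter)

lemma rel_compl_eq:
  assumes "A \<in> \<B>" "B \<in> \<B>"
  shows "rel_compl (set_gorder \<B>) A B = A - B"
proof -
  note c = S.rel_compl[of A B, simplified, OF assms]
  have "rel_compl (set_gorder \<B>) A B \<inter> B = {}"
    using c(2) by (simp only: meet_eq[OF c(1) assms(2)] bottom_eq)
  moreover have "rel_compl (set_gorder \<B>) A B \<union> (A \<inter> B) = A"
    using c(3) by (simp only: meet_eq[OF assms] join_eq[OF c(1) inter[OF assms]])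
  ultimately show ?thesis by blast
qed

end

lemma rel_range_union: "rel_range G lab (A \<union> B) a = rel_range G lab A a \<union> rel_range G lab B a"
  by (auto simp: rel_range_def)

lemma rel_range_empty: "rel_range G lab {} a = {}"
  by (auto simp: rel_range_def)

context generalized_labelled_space
begin

sublocale SR: set_ring \<B>
  by unfold_locales (fact empty_closed union_closed inter_closed diff_closed)+

lemma rel_range_diff:
  assumes "A \<in> \<B>" "B \<in> \<B>" "a \<in> L"
  shows "rel_range G lab (A - B) a = rel_range G lab A a - rel_range G lab B a"
proof -
  have "rel_range G lab A a = rel_range G lab (A - B) a \<union> rel_range G lab (A \<inter> B) a"
    by (metis Un_Diff_Int rel_range_union)
  moreover have "rel_range G lab (A - B) a \<inter> rel_range G lab B a = {}"
    using weakly_left_resolving[OF diff_closed[OF assms(1,2)] assms(2,3)]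
    by (metis Diff_disjoint Int_commute rel_range_empty)
  ultimately show ?thesis
    using weakly_left_resolving[OF assms] by blast
qed

lemma gbds: "generalized_boolean_dynamical_system (set_gorder \<B>) L (\<lambda>a A. rel_range G lab A a) I"
proof
  show "gba_morphism (set_gorder \<B>) (set_gorder \<B>) (\<lambda>A. rel_range G lab A a)" if "a \<in> L" for a
    using that by (auto simp: gba_morphism_def SR.join_eq SR.meet_eq SR.bottom_eq SR.rel_compl_eq
      range_closed rel_range_union rel_range_empty rel_range_diff weakly_left_resolving)
  show "gba_ideal (set_gorder \<B>) (I a)" if "a \<in> L" for a
    using ideal[OF that] by (auto simp: gba_ideal_def set_ideal_def SR.join_eq SR.meet_eq subset_iff)
  show "{A \<in> carrier (set_gorder \<B>). \<exists>B \<in> carrier (set_gorder \<B>).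
      A \<sqsubseteq>\<^bsub>set_gorder \<B>\<^esub> rel_range G lab B a} \<subseteq> I a" if "a \<in> L" for a
    using range_in_ideal[OF that] by simp
qed

lemma gbds_delta_eq: "gbds_delta (set_gorder \<B>) L (\<lambda>a A. rel_range G lab A a) = gls_delta G L lab"
  by (auto simp: fun_eq_iff gbds_delta_def gls_delta_def SR.bottom_eq)

lemma gbds_reg_eq: "gbds_reg (set_gorder \<B>) L (\<lambda>a A. rel_range G lab A a) = gls_reg G L lab \<B>"
  by (auto simp: gbds_reg_def gls_reg_def gbds_delta_eq SR.bottom_eq)

text \<open>The relations correspond one to one: on \<open>\<B>\<close>, the lattice operations of the order by inclusion are
  union and intersection.\<close>

lemma gbds_relations_eq:
  "gbds_relations (set_gorder \<B>) L (\<lambda>a A. rel_range G lab A a) I = gls_relations G L lab \<B> I"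
    (is "?E = ?F")
proof -
  have I: "A \<in> \<B>" if "a \<in> L" "A \<in> I a" for a A
    using ideal[of a] that by (auto simp: set_ideal_def)
  have "(s, t) \<in> ?F" if "(s, t) \<in> ?E" for s t
    using that
  proof cases
    case p_empty
    then show ?thesis
      using gls_relations.p_empty[where G = G and L = L and lab = lab and \<B> = \<B> and I = I]
      by (simp add: SR.join_eq SR.meet_eq SR.bottom_eq gbds_reg_eq gbds_delta_eq I)
  next
    case (p_meet x y)
    then show ?thesis
      using gls_relations.p_inter[where A = x and B = y
          and G = G and L = L and lab = lab and \<B> = \<B> and I = I]
      by (simp add: SR.join_eq SR.meet_eq SR.bottom_eq gbds_reg_eq gbds_delta_eq I)
  next
    case (p_join x y)
    then show ?thesis
      using gls_relations.p_union[where A = x and B = y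
          and G = G and L = L and lab = lab and \<B> = \<B> and I = I]
      by (simp add: SR.join_eq SR.meet_eq SR.bottom_eq gbds_reg_eq gbds_delta_eq I)
  next
    case (p_s x \<alpha> y)
    then show ?thesis
      using gls_relations.p_s[where B = x and a = \<alpha> and A = y
          and G = G and L = L and lab = lab and \<B> = \<B> and I = I]
      by (simp add: SR.join_eq SR.meet_eq SR.bottom_eq gbds_reg_eq gbds_delta_eq I)
  next
    case (sstar_p x \<alpha> y)
    then show ?thesis
      using gls_relations.sstar_p[where B = x and a = \<alpha> and A = y
          and G = G and L = L and lab = lab and \<B> = \<B> and I = I]
      by (simp add: SR.join_eq SR.meet_eq SR.bottom_eq gbds_reg_eq gbds_delta_eq I)
  next
    case (sstar_s \<alpha> y \<alpha>' y')
    then show ?thesis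
      using gls_relations.sstar_s[where a = \<alpha> and A = y and a' = \<alpha>' and A' = y'
          and G = G and L = L and lab = lab and \<B> = \<B> and I = I]
      by (auto simp: SR.meet_eq I[of \<alpha> y] I[of \<alpha>' y'] split: if_splits)
  next
    case (s_p \<alpha> y y')
    then show ?thesis
      using gls_relations.s_p[where a = \<alpha> and A = y and B = y'
          and G = G and L = L and lab = lab and \<B> = \<B> and I = I]
      by (simp add: SR.join_eq SR.meet_eq SR.bottom_eq gbds_reg_eq gbds_delta_eq I)
  next
    case (p_sstar \<alpha> y y')
    then show ?thesis
      using gls_relations.p_sstar[where a = \<alpha> and A = y and B = y'
          and G = G and L = L and lab = lab and \<B> = \<B> and I = I]
      by (simp add: SR.join_eq SR.meet_eq SR.bottom_eq gbds_reg_eq gbds_delta_eq I)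
  next
    case (cuntz_krieger x \<alpha>s)
    then show ?thesis
      using gls_relations.cuntz_krieger[where A = x and as = \<alpha>s
          and G = G and L = L and lab = lab and \<B> = \<B> and I = I]
      by (simp add: SR.join_eq SR.meet_eq SR.bottom_eq gbds_reg_eq gbds_delta_eq I)
  qed
  moreover have "(s, t) \<in> ?E" if "(s, t) \<in> ?F" for s t
    using that
  proof cases
    case p_empty
    then show ?thesis
      using gbds_relations.p_empty[where B = "set_gorder \<B>" and L = L and \<theta> = "\<lambda>a A. rel_range G lab A a" and I = I]
      by (simp add: SR.join_eq SR.meet_eq SR.bottom_eq gbds_reg_eq gbds_delta_eq I)
  next
    case (p_inter A C)
    then show ?thesis
      using gbds_relations.p_meet[where x = A and y = C
          and B = "set_gorder \<B>" and L = L and \<theta> = "\<lambda>a A. rel_range G lab A a" and I = I]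
      by (simp add: SR.join_eq SR.meet_eq SR.bottom_eq gbds_reg_eq gbds_delta_eq I)
  next
    case (p_union A C)
    then show ?thesis
      using gbds_relations.p_join[where x = A and y = C
          and B = "set_gorder \<B>" and L = L and \<theta> = "\<lambda>a A. rel_range G lab A a" and I = I]
      by (simp add: SR.join_eq SR.meet_eq SR.bottom_eq gbds_reg_eq gbds_delta_eq I)
  next
    case (p_s C a A)
    then show ?thesis
      using gbds_relations.p_s[where x = C and \<alpha> = a and y = A
          and B = "set_gorder \<B>" and L = L and \<theta> = "\<lambda>a A. rel_range G lab A a" and I = I]
      by (simp add: SR.join_eq SR.meet_eq SR.bottom_eq gbds_reg_eq gbds_delta_eq I)
  next
    case (sstar_p C a A)
    then show ?thesis
      using gbds_relations.sstar_p[where x = C and \<alpha> = a and y = A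
          and B = "set_gorder \<B>" and L = L and \<theta> = "\<lambda>a A. rel_range G lab A a" and I = I]
      by (simp add: SR.join_eq SR.meet_eq SR.bottom_eq gbds_reg_eq gbds_delta_eq I)
  next
    case (sstar_s a A a' A')
    then show ?thesis
      using gbds_relations.sstar_s[where \<alpha> = a and y = A and \<alpha>' = a' and y' = A'
          and B = "set_gorder \<B>" and L = L and \<theta> = "\<lambda>a A. rel_range G lab A a" and I = I]
      by (auto simp: SR.meet_eq I[of a A] I[of a' A'] split: if_splits)
  next
    case (s_p a A C)
    then show ?thesis
      using gbds_relations.s_p[where \<alpha> = a and y = A and y' = C
          and B = "set_gorder \<B>" and L = L and \<theta> = "\<lambda>a A. rel_range G lab A a" and I = I]
      by (simp add: SR.join_eq SR.meet_eq SR.bottom_eq gbds_reg_eq gbds_delta_eq I)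
  next
    case (p_sstar a A C)
    then show ?thesis
      using gbds_relations.p_sstar[where \<alpha> = a and y = A and y' = C
          and B = "set_gorder \<B>" and L = L and \<theta> = "\<lambda>a A. rel_range G lab A a" and I = I]
      by (simp add: SR.join_eq SR.meet_eq SR.bottom_eq gbds_reg_eq gbds_delta_eq I)
  next
    case (cuntz_krieger A as)
    then show ?thesis
      using gbds_relations.cuntz_krieger[where x = A and \<alpha>s = as
          and B = "set_gorder \<B>" and L = L and \<theta> = "\<lambda>a A. rel_range G lab A a" and I = I]
      by (simp add: SR.join_eq SR.meet_eq SR.bottom_eq gbds_reg_eq gbds_delta_eq I)
  qed
  ultimately show ?thesis by auto
qed

lemma gbds_algebra_eq:
  "gbds_algebra R (set_gorder \<B>) L (\<lambda>a A. rel_range G lab A a) I = gls_algebra R G L lab \<B> I"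
  by (simp add: gbds_algebra_def gls_algebra_def gbds_relations_eq gbds_generators_def
      gls_generators_def)

end


section \<open>The labelled space of prime filters\<close>

text \<open>The equivalence for meets makes \<open>F\<close> upward closed. The empty set counts as a proper filter, so
  that the union of an arbitrary chain is again one.\<close>

definition proper_filter :: "('b, 'm) gorder_scheme \<Rightarrow> 'b set \<Rightarrow> bool"
  where "proper_filter B F \<longleftrightarrow> F \<subseteq> carrier B \<and> \<bottom>\<^bsub>B\<^esub> \<notin> F \<and>
    (\<forall>x \<in> carrier B. \<forall>y \<in> carrier B. x \<sqinter>\<^bsub>B\<^esub> y \<in> F \<longleftrightarrow> x \<in> F \<and> y \<in> F)"

text \<open>A nonempty proper filter that is prime for joins.\<close>

definition prime_filter :: "('b, 'm) gorder_scheme \<Rightarrow> 'b set \<Rightarrow> bool"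
  where "prime_filter B \<xi> \<longleftrightarrow> \<xi> \<subseteq> carrier B \<and> \<xi> \<noteq> {} \<and> \<bottom>\<^bsub>B\<^esub> \<notin> \<xi> \<and>
    (\<forall>x \<in> carrier B. \<forall>y \<in> carrier B. x \<sqinter>\<^bsub>B\<^esub> y \<in> \<xi> \<longleftrightarrow> x \<in> \<xi> \<and> y \<in> \<xi>) \<and>
    (\<forall>x \<in> carrier B. \<forall>y \<in> carrier B. x \<squnion>\<^bsub>B\<^esub> y \<in> \<xi> \<longleftrightarrow> x \<in> \<xi> \<or> y \<in> \<xi>)"

text \<open>The Stone map sends \<open>x\<close> to the basic open set of the prime filters that contain \<open>x\<close>.\<close>

definition stone :: "('b, 'm) gorder_scheme \<Rightarrow> 'b \<Rightarrow> 'b set set"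
  where "stone B x = {\<xi>. prime_filter B \<xi> \<and> x \<in> \<xi>}"

text \<open>The vertices are the prime filters. An edge labelled \<open>\<alpha>\<close> with range \<open>\<eta>\<close> has the preimage of \<open>\<eta>\<close>
  under \<open>\<theta> \<alpha>\<close> as its source, so there is at most one; there is none if that preimage is empty. An
  edge is encoded as the triple of its source, its label and its range.\<close>

definition stone_graph ::
    "('b, 'm) gorder_scheme \<Rightarrow> 'l set \<Rightarrow> ('l \<Rightarrow> 'b \<Rightarrow> 'b) \<Rightarrow> ('b set, 'b set \<times> 'l \<times> 'b set) pre_digraph"
  where "stone_graph B L \<theta> =
    \<lparr>verts = {\<xi>. prime_filter B \<xi>},
     arcs = {(\<xi>, \<alpha>, \<eta>). \<alpha> \<in> L \<and> prime_filter B \<xi> \<and> prime_filter B \<eta> \<and>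
       \<xi> = {x \<in> carrier B. \<theta> \<alpha> x \<in> \<eta>}},
     tail = (\<lambda>(\<xi>, \<alpha>, \<eta>). \<xi>), head = (\<lambda>(\<xi>, \<alpha>, \<eta>). \<eta>)\<rparr>"

abbreviation stone_label :: "'b set \<times> 'l \<times> 'b set \<Rightarrow> 'l"
  where "stone_label \<equiv> \<lambda>(\<xi>, \<alpha>, \<eta>). \<alpha>"

context generalized_boolean_algebra
begin

lemma meet_eq_left: "\<lbrakk>x \<in> carrier B; y \<in> carrier B; x \<sqsubseteq> y\<rbrakk> \<Longrightarrow> x \<sqinter> y = x"
  using le_iff_join by simp

lemma le_bottom_eq: "\<lbrakk>x \<in> carrier B; x \<sqsubseteq> \<bottom>\<rbrakk> \<Longrightarrow> x = \<bottom>"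
  by (simp add: bottom_lower le_antisym)

lemma bottom_join_eq: "x \<in> carrier B \<Longrightarrow> \<bottom> \<squnion> x = x"
  by (meson bottom_closed bottom_lower le_iff_meet)

lemma le_meet_iff:
  "\<lbrakk>x \<in> carrier B; y \<in> carrier B; z \<in> carrier B\<rbrakk> \<Longrightarrow> z \<sqsubseteq> x \<sqinter> y \<longleftrightarrow> z \<sqsubseteq> x \<and> z \<sqsubseteq> y"
  by (meson le_trans meet_closed meet_le meet_left meet_right)

lemma proper_filter_principal:
  assumes "a \<in> carrier B" "a \<noteq> \<bottom>"
  shows "proper_filter B {z \<in> carrier B. a \<sqsubseteq> z}"
  using assms le_bottom_eq[of a] by (auto simp: proper_filter_def le_meet_iff)

lemma proper_filter_Union:
  assumes C: "subset.chain (Collect (proper_filter B)) C"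
  shows "proper_filter B (\<Union>C)"
proof -
  have filt: "proper_filter B F" if "F \<in> C" for F
    using C that by (auto simp: subset_chain_def)
  have both: "\<exists>F \<in> C. x \<in> F \<and> y \<in> F" if xy: "x \<in> \<Union>C" "y \<in> \<Union>C" for x y
  proof -
    obtain F G where FG: "F \<in> C" "x \<in> F" "G \<in> C" "y \<in> G" using xy by blast
    then have "F \<subseteq> G \<or> G \<subseteq> F" using C by (simp add: subset_chain_def)
    then show ?thesis using FG by blast
  qed
  have "x \<sqinter> y \<in> \<Union>C \<longleftrightarrow> x \<in> \<Union>C \<and> y \<in> \<Union>C" if xy: "x \<in> carrier B" "y \<in> carrier B" for x y
  proof -
    have *: "x \<sqinter> y \<in> F \<longleftrightarrow> x \<in> F \<and> y \<in> F" if "F \<in> C" for F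
      using filt[OF that] xy by (simp add: proper_filter_def)
    show ?thesis
    proof
      assume "x \<in> \<Union>C \<and> y \<in> \<Union>C"
      then show "x \<sqinter> y \<in> \<Union>C" using both[of x y] * by auto
    qed (use * in auto)
  qed
  moreover have "\<Union>C \<subseteq> carrier B" "\<bottom> \<notin> \<Union>C"
    using filt unfolding proper_filter_def by blast+
  ultimately show ?thesis by (simp add: proper_filter_def)
qed

text \<open>The filter generated by a nonempty filter \<open>M\<close> and an element \<open>x\<close> is proper if \<open>x\<close> meets every
  element of \<open>M\<close>. For empty \<open>M\<close> the set below is empty.\<close>

lemma filter_adjoin:
  assumes M: "proper_filter B M" and x: "x \<in> carrier B" and ne: "\<And>c. c \<in> M \<Longrightarrow> c \<sqinter> x \<noteq> \<bottom>"
  shows "proper_filter B {z \<in> carrier B. \<exists>c \<in> M. c \<sqinter> x \<sqsubseteq> z}"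
proof -
  let ?F = "{z \<in> carrier B. \<exists>c \<in> M. c \<sqinter> x \<sqsubseteq> z}"
  have MB: "c \<in> carrier B" if "c \<in> M" for c using M that by (auto simp: proper_filter_def)
  have M_meet: "c \<sqinter> d \<in> M" if "c \<in> M" "d \<in> M" for c d
    using M that MB by (simp add: proper_filter_def)
  have "v \<sqinter> w \<in> ?F \<longleftrightarrow> v \<in> ?F \<and> w \<in> ?F" if vw: "v \<in> carrier B" "w \<in> carrier B" for v w
  proof
    assume "v \<sqinter> w \<in> ?F"
    then obtain c where "c \<in> M" "c \<sqinter> x \<sqsubseteq> v \<sqinter> w" by blast
    then show "v \<in> ?F \<and> w \<in> ?F" using vw x MB[of c] by (auto simp: le_meet_iff)
  next
    assume "v \<in> ?F \<and> w \<in> ?F"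
    then obtain c d where cd: "c \<in> M" "d \<in> M" "c \<sqinter> x \<sqsubseteq> v" "d \<sqinter> x \<sqsubseteq> w" by blast
    \<comment> \<open>The meet of \<open>c\<close> and \<open>d\<close> witnesses membership of the meet of \<open>v\<close> and \<open>w\<close>.\<close>
    note cdB = MB[OF cd(1)] MB[OF cd(2)]
    have le: "(c \<sqinter> d) \<sqinter> x \<sqsubseteq> c" "(c \<sqinter> d) \<sqinter> x \<sqsubseteq> d" "(c \<sqinter> d) \<sqinter> x \<sqsubseteq> x"
      using cdB x by (meson le_trans meet_closed meet_left meet_right)+
    then have "(c \<sqinter> d) \<sqinter> x \<sqsubseteq> c \<sqinter> x" "(c \<sqinter> d) \<sqinter> x \<sqsubseteq> d \<sqinter> x"
      using cdB x by (simp_all add: le_meet_iff)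
    then have "(c \<sqinter> d) \<sqinter> x \<sqsubseteq> v" "(c \<sqinter> d) \<sqinter> x \<sqsubseteq> w"
      using cd(3,4) cdB x vw by (meson le_trans meet_closed)+
    then have "(c \<sqinter> d) \<sqinter> x \<sqsubseteq> v \<sqinter> w"
      using cdB x vw by (simp add: le_meet_iff)
    then show "v \<sqinter> w \<in> ?F" using vw M_meet[OF cd(1,2)] by auto
  qed
  moreover have "\<bottom> \<notin> ?F"
  proof
    assume "\<bottom> \<in> ?F"
    then obtain c where c: "c \<in> M" "c \<sqinter> x \<sqsubseteq> \<bottom>" by blast
    then show False using ne[OF c(1)] le_bottom_eq[of "c \<sqinter> x"] MB[OF c(1)] x by simp
  qed
  ultimately show ?thesis by (simp add: proper_filter_def)
qed

lemma maximal_proper_filter_prime: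
  assumes M: "proper_filter B M" "M \<noteq> {}"
    and max: "\<And>F. \<lbrakk>proper_filter B F; M \<subseteq> F\<rbrakk> \<Longrightarrow> F = M"
  shows "prime_filter B M"
proof -
  have MB: "c \<in> carrier B" if "c \<in> M" for c using M that by (auto simp: proper_filter_def)
  have meet_iff: "x \<sqinter> y \<in> M \<longleftrightarrow> x \<in> M \<and> y \<in> M" if "x \<in> carrier B" "y \<in> carrier B" for x y
    using M that by (simp add: proper_filter_def)
  have prime: "y \<in> M" if x: "x \<in> carrier B" and y: "y \<in> carrier B" and xy: "x \<squnion> y \<in> M" "x \<notin> M" for x y
  proof -
    let ?F = "{z \<in> carrier B. \<exists>c \<in> M. c \<sqinter> x \<sqsubseteq> z}"
    have "M \<subseteq> ?F" using MB x meet_left by blast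
    moreover have "x \<in> ?F" using MB x meet_right \<open>M \<noteq> {}\<close> by blast
    \<comment> \<open>Since \<open>?F\<close> is larger than \<open>M\<close>, it is not proper, so some \<open>c\<close> in \<open>M\<close> is disjoint from \<open>x\<close>.\<close>
    ultimately have "\<not> proper_filter B ?F" using max[of ?F] xy by blast
    then obtain c where c: "c \<in> M" "c \<sqinter> x = \<bottom>" using filter_adjoin[OF M(1) x] by blast
    have "c \<sqinter> (x \<squnion> y) = c \<sqinter> y"
      using c MB[OF c(1)] x y by (simp add: meet_join_distrib bottom_join_eq)
    moreover have "c \<sqinter> (x \<squnion> y) \<in> M" using c MB[OF c(1)] x y xy by (simp add: meet_iff)
    ultimately show "y \<in> M" using MB[OF c(1)] y by (simp add: meet_iff)
  qed
  have up: "y \<in> M" if "x \<in> M" "y \<in> carrier B" "x \<sqsubseteq> y" for x y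
    using meet_iff[OF MB[OF that(1)] that(2)] meet_eq_left[OF MB[OF that(1)] that(2,3)] that(1) by simp
  have join_iff: "x \<squnion> y \<in> M \<longleftrightarrow> x \<in> M \<or> y \<in> M" if xy: "x \<in> carrier B" "y \<in> carrier B" for x y
    using prime[OF xy] up[of _ "x \<squnion> y"] join_left[OF xy] join_right[OF xy] join_closed[OF xy] by blast
  show ?thesis
    using M MB meet_iff join_iff by (simp add: prime_filter_def proper_filter_def)
qed

lemma prime_filter_exists:
  assumes a: "a \<in> carrier B" "a \<noteq> \<bottom>"
  obtains \<xi> where "prime_filter B \<xi>" "a \<in> \<xi>"
proof -
  let ?P = "{z \<in> carrier B. a \<sqsubseteq> z}"
  let ?A = "{F. proper_filter B F \<and> ?P \<subseteq> F}"
  have "\<exists>M \<in> ?A. \<forall>F \<in> ?A. M \<subseteq> F \<longrightarrow> F = M"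
  proof (rule subset_Zorn_nonempty)
    show "?A \<noteq> {}" using proper_filter_principal[OF a] by blast
    fix C assume "C \<noteq> {}" and C: "subset.chain ?A C"
    then have "subset.chain (Collect (proper_filter B)) C" by (auto simp: subset_chain_def)
    moreover have "?P \<subseteq> F" if "F \<in> C" for F using C that by (auto simp: subset_chain_def)
    ultimately show "\<Union>C \<in> ?A"
      using proper_filter_Union \<open>C \<noteq> {}\<close> by blast
  qed
  then obtain M where M: "proper_filter B M" "?P \<subseteq> M"
    and maxA: "\<And>F. \<lbrakk>F \<in> ?A; M \<subseteq> F\<rbrakk> \<Longrightarrow> F = M"
    by auto
  have max: "F = M" if "proper_filter B F" "M \<subseteq> F" for F
    using that M(2) by (intro maxA) auto
  have "a \<in> M" using M(2) a by auto
  then show thesis using that maximal_proper_filter_prime[OF M(1) _ max] by blast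
qed

lemma stone_join: "\<lbrakk>x \<in> carrier B; y \<in> carrier B\<rbrakk> \<Longrightarrow> stone B (x \<squnion> y) = stone B x \<union> stone B y"
  by (auto simp: stone_def prime_filter_def)

lemma stone_meet: "\<lbrakk>x \<in> carrier B; y \<in> carrier B\<rbrakk> \<Longrightarrow> stone B (x \<sqinter> y) = stone B x \<inter> stone B y"
  by (auto simp: stone_def prime_filter_def)

lemma stone_bottom: "stone B \<bottom> = {}"
  by (auto simp: stone_def prime_filter_def)

lemma stone_rel_compl:
  assumes "x \<in> carrier B" "y \<in> carrier B"
  shows "stone B (rel_compl B x y) = stone B x - stone B y"
proof -
  note c = rel_compl[OF assms]
  have "stone B (rel_compl B x y) \<inter> stone B y = {}"
    using stone_meet[OF c(1) assms(2)] by (simp add: c stone_bottom)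
  moreover have "stone B (rel_compl B x y) \<union> (stone B x \<inter> stone B y) = stone B x"
    using stone_join[OF c(1) meet_closed[OF assms]] assms by (simp add: c stone_meet)
  ultimately show ?thesis by auto
qed

text \<open>If \<open>x\<close> is not below \<open>y\<close>, then the relative complement of \<open>y\<close> in \<open>x\<close> is nonzero, and a prime
  filter that contains it contains \<open>x\<close> but not \<open>y\<close>.\<close>

lemma stone_subset_iff:
  assumes "x \<in> carrier B" "y \<in> carrier B"
  shows "stone B x \<subseteq> stone B y \<longleftrightarrow> x \<sqsubseteq> y"
proof
  assume "stone B x \<subseteq> stone B y"
  note c = rel_compl[OF assms]
  from \<open>stone B x \<subseteq> stone B y\<close> have "stone B (rel_compl B x y) = {}"
    using assms by (simp add: stone_rel_compl)
  then have "rel_compl B x y = \<bottom>"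
    using prime_filter_exists[OF c(1)] by (auto simp: stone_def)
  then have "x \<sqinter> y = x" using c(3) assms by (simp add: bottom_join_eq)
  then show "x \<sqsubseteq> y" using assms le_iff_join by metis
next
  assume "x \<sqsubseteq> y"
  then show "stone B x \<subseteq> stone B y"
    using stone_meet[OF assms] assms by (simp add: meet_eq_left) blast
qed

lemma stone_inj: "inj_on (stone B) (carrier B)"
  by (auto intro!: inj_onI le_antisym simp flip: stone_subset_iff)

end

context generalized_boolean_dynamical_system
begin

text \<open>The preimage of a prime filter under a morphism satisfies all conditions for a prime filter except
  possibly nonemptiness; the element \<open>x\<close> witnesses that.\<close>

lemma prime_filter_preimage:
  assumes "\<alpha> \<in> L" "prime_filter B \<eta>" "x \<in> carrier B" "\<theta> \<alpha> x \<in> \<eta>"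
  shows "prime_filter B {x \<in> carrier B. \<theta> \<alpha> x \<in> \<eta>}"
  using assms action_morphism[OF assms(1)]
  by (auto simp: prime_filter_def gba_morphism_def Pi_iff)

lemma rel_range_stone:
  assumes "\<alpha> \<in> L" "x \<in> carrier B"
  shows "rel_range (stone_graph B L \<theta>) stone_label (stone B x) \<alpha> = stone B (\<theta> \<alpha> x)"
proof
  show "rel_range (stone_graph B L \<theta>) stone_label (stone B x) \<alpha> \<subseteq> stone B (\<theta> \<alpha> x)"
    by (auto simp: rel_range_def stone_graph_def stone_def)
  show "stone B (\<theta> \<alpha> x) \<subseteq> rel_range (stone_graph B L \<theta>) stone_label (stone B x) \<alpha>"
  proof
    fix \<eta> assume "\<eta> \<in> stone B (\<theta> \<alpha> x)"
    then have \<eta>: "prime_filter B \<eta>" "\<theta> \<alpha> x \<in> \<eta>" by (auto simp: stone_def)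
    then show "\<eta> \<in> rel_range (stone_graph B L \<theta>) stone_label (stone B x) \<alpha>"
      using assms prime_filter_preimage[OF assms(1) \<eta>(1) assms(2) \<eta>(2)]
      by (auto simp: rel_range_def stone_graph_def stone_def
          intro!: bexI[of _ "({x \<in> carrier B. \<theta> \<alpha> x \<in> \<eta>}, \<alpha>, \<eta>)"])
  qed
qed

lemma stone_labelled_space:
  "generalized_labelled_space (stone_graph B L \<theta>) L stone_label (stone B ` carrier B)
    (\<lambda>\<alpha>. stone B ` I \<alpha>)"
proof
  fix e assume "e \<in> arcs (stone_graph B L \<theta>)"
  then show "tail (stone_graph B L \<theta>) e \<in> verts (stone_graph B L \<theta>)"
    "head (stone_graph B L \<theta>) e \<in> verts (stone_graph B L \<theta>)" "stone_label e \<in> L"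
    by (auto simp: stone_graph_def)
next
  fix X assume "X \<in> stone B ` carrier B"
  then show "X \<subseteq> verts (stone_graph B L \<theta>)" by (auto simp: stone_graph_def stone_def)
next
  show "{} \<in> stone B ` carrier B" using stone_bottom by (metis bottom_closed imageI)
next
  fix X Y assume "X \<in> stone B ` carrier B" "Y \<in> stone B ` carrier B"
  then obtain x y where xy: "x \<in> carrier B" "y \<in> carrier B" "X = stone B x" "Y = stone B y" by auto
  show "X \<union> Y \<in> stone B ` carrier B" "X \<inter> Y \<in> stone B ` carrier B" "X - Y \<in> stone B ` carrier B"
    using xy rel_compl(1)[of x y] by (auto simp flip: stone_join stone_meet stone_rel_compl)
  fix a assume "a \<in> L"
  then show "rel_range (stone_graph B L \<theta>) stone_label (X \<inter> Y) a =
      rel_range (stone_graph B L \<theta>) stone_label X a \<inter> rel_range (stone_graph B L \<theta>) stone_label Y a"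
    using xy action_morphism[of a] action_closed[of a]
    by (simp add: rel_range_stone gba_morphism_def flip: stone_meet)
next
  fix X a assume "X \<in> stone B ` carrier B" "a \<in> L"
  then show "rel_range (stone_graph B L \<theta>) stone_label X a \<in> stone B ` carrier B"
    using action_closed by (auto simp: rel_range_stone)
next
  fix a assume a: "a \<in> L"
  note sub = ideal_subset[OF a]
  show "set_ideal (stone B ` carrier B) (stone B ` I a)"
    using ideal[OF a] sub
    by (auto simp: set_ideal_def gba_ideal_def subset_iff simp flip: stone_join stone_meet)
  show "{X \<in> stone B ` carrier B. \<exists>Y \<in> stone B ` carrier B.
      X \<subseteq> rel_range (stone_graph B L \<theta>) stone_label Y a} \<subseteq> stone B ` I a"
  proof clarify
    fix x y
    assume xy: "x \<in> carrier B" "y \<in> carrier B"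
      and "stone B x \<subseteq> rel_range (stone_graph B L \<theta>) stone_label (stone B y) a"
    then have "x \<sqsubseteq> \<theta> a y"
      using a action_closed by (simp add: rel_range_stone stone_subset_iff)
    then show "stone B x \<in> stone B ` I a"
      using range_in_ideal[OF a] xy by blast
  qed
qed

lemma stone_gbds_iso:
  "gbds_iso B L \<theta> I (set_gorder (stone B ` carrier B))
    (\<lambda>a A. rel_range (stone_graph B L \<theta>) stone_label A a) (\<lambda>\<alpha>. stone B ` I \<alpha>) (stone B)"
proof -
  interpret S: generalized_labelled_space "stone_graph B L \<theta>" L stone_label "stone B ` carrier B"
    "\<lambda>\<alpha>. stone B ` I \<alpha>"
    by (rule stone_labelled_space)
  interpret D': generalized_boolean_dynamical_system "set_gorder (stone B ` carrier B)" L
    "\<lambda>a A. rel_range (stone_graph B L \<theta>) stone_label A a" "\<lambda>\<alpha>. stone B ` I \<alpha>"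
    by (rule S.gbds)
  show ?thesis
    by unfold_locales
      (auto simp: bij_betw_def stone_inj stone_bottom stone_join stone_meet rel_range_stone
        S.SR.bottom_eq S.SR.join_eq S.SR.meet_eq)
qed

end


section \<open>Equality of the two classes of algebras\<close>

theorem corollary8p10:
  fixes R :: "('r, 'm) ring_scheme" and A :: "('r, 'a, 'n) module_scheme"
  assumes "cring R" and "nonunital_algebra R A"
  shows "((\<exists>(B :: 'b gorder) (L :: 'l set) \<theta> I.
             generalized_boolean_dynamical_system B L \<theta> I \<and>
             algebra_isomorphic R A (gbds_algebra R B L \<theta> I))
          \<longrightarrow>
          (\<exists>(G :: ('b set, 'b set \<times> 'l \<times> 'b set) pre_digraph) (L :: 'l set) lab \<B> I.
             generalized_labelled_space G L lab \<B> I \<and>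
             algebra_isomorphic R A (gls_algebra R G L lab \<B> I)))
       \<and>
         ((\<exists>(G :: ('v, 'e) pre_digraph) (L :: 'k set) lab \<B> I.
             generalized_labelled_space G L lab \<B> I \<and>
             algebra_isomorphic R A (gls_algebra R G L lab \<B> I))
          \<longrightarrow>
          (\<exists>(B :: 'v set gorder) (L :: 'k set) \<theta> I.
             generalized_boolean_dynamical_system B L \<theta> I \<and>
             algebra_isomorphic R A (gbds_algebra R B L \<theta> I)))"
proof (intro conjI impI; elim exE conjE)
  fix B :: "'b gorder" and L :: "'l set" and \<theta> I
  assume "generalized_boolean_dynamical_system B L \<theta> I"
    and iso: "algebra_isomorphic R A (gbds_algebra R B L \<theta> I)"
  then interpret generalized_boolean_dynamical_system B L \<theta> I by simp
  interpret S: generalized_labelled_space "stone_graph B L \<theta>" L stone_label "stone B ` carrier B"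
    "\<lambda>\<alpha>. stone B ` I \<alpha>"
    by (rule stone_labelled_space)
  have "algebra_isomorphic R A
      (gls_algebra R (stone_graph B L \<theta>) L stone_label (stone B ` carrier B) (\<lambda>\<alpha>. stone B ` I \<alpha>))"
    using algebra_isomorphic_trans[OF iso gbds_iso.algebra_isomorphic[OF stone_gbds_iso assms(1)]]
    by (simp only: S.gbds_algebra_eq)
  with S.generalized_labelled_space_axioms
  show "\<exists>(G :: ('b set, 'b set \<times> 'l \<times> 'b set) pre_digraph) (L :: 'l set) lab \<B> I.
      generalized_labelled_space G L lab \<B> I \<and> algebra_isomorphic R A (gls_algebra R G L lab \<B> I)"
    by blast
next
  fix G :: "('v, 'e) pre_digraph" and L :: "'k set" and lab \<B> I
  assume S: "generalized_labelled_space G L lab \<B> I"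
    and iso: "algebra_isomorphic R A (gls_algebra R G L lab \<B> I)"
  show "\<exists>(B :: 'v set gorder) (L :: 'k set) \<theta> I.
      generalized_boolean_dynamical_system B L \<theta> I \<and> algebra_isomorphic R A (gbds_algebra R B L \<theta> I)"
    using generalized_labelled_space.gbds[OF S] iso
    unfolding generalized_labelled_space.gbds_algebra_eq[OF S, symmetric] by blast
qed

end
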